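(* Let $\Omega$ be a polygon in $\mathbb{R}^2$ and $\{(x_j,y_j)\}_{j=1}^m$ a set of scattered points in $\Omega$ with the vertices of $\Omega$ included. Let $\triangle$ be a triangulation of $\Omega$ generated from $\{(x_j,y_j)\}_{j=1}^m$. Then the quadrature rule $\sum_{j=1}^m w_jf(x_j,y_j)\approx\int_\Omega f(x,y)\,dx\,dy$ with weights $$w_j:=\sum_{T\in\triangle:\,(x_j,y_j)\in T}\frac{A_T}{3}$$ is exact for all constant and linear polynomials, that is, $$\sum_{j=1}^mw_{j}\chi(x_j,y_j) = \int_{\Omega}\chi(x,y)\,dx\,dy\qquad \forall\, \chi\in\mathbb{P}_1.$$ Besides, for any $f\in W^{2,p}(\Omega)$ with $1\leq p\leq \infty$, the quadrature rule satisfies $$\left|\int_{\Omega}f(x,y)\,dx\,dy - \sum_{j=1}^mw_{j}f(x_j,y_j)\right|\leq K_1C_7\max_{T\in\triangle}|A_T|^{1/q}\,|f|_{2, p, \Omega},$$ where $1/p+1/q =1$ and $K_1,C_7>0$ are the constants described in the context.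
   Context: A polygon $\Omega\subset\mathbb{R}^2$ is a regular or irregular polygonal domain whose boundary consists of piecewise line segments. A triangulation $\triangle=\{T_1,\dots,T_n\}$ of $\Omega$ is a collection of triangles with $\Omega=\bigcup_i T_i$ such that any two triangles that intersect do so at either a common vertex or a common edge; it is generated from $\{(x_j,y_j)\}_{j=1}^m$ if these points are the vertices of the triangles. For a triangle $T$, $A_T$ is its area, $|T|$ its longest edge length, $\rho_T$ the radius of its largest inscribed disk, $\kappa_T=|T|/\rho_T$. $|\triangle|$ is the longest edge length in $\triangle$ and $\#\triangle$ is the number of triangles. $w_j$ is one third of the total area of the triangles having $(x_j,y_j)$ as a vertex. $\mathbb{P}_1$ is the space of bivariate real polynomials of degree at most $1$. The Sobolev semi-norm is $|f|_{k,p,\Omega}=\big[\sum_{\nu+\mu=k}\|D_x^\nu D_y^\mu f\|_{p,\Omega}^p\big]^{1/p}$ for $1\le p<\infty$ and $|f|_{k,\infty,\Omega}=\max_{\nu+\mu=k}\|D_x^\nu D_y^\mu f\|_{\infty,\Omega}$, with $\|\cdot\|_{p,\Omega}$ the $L^p(\Omega)$ norm (similarly on $T$); $W^{2,p}(\Omega)$ is the usual Sobolev space and point values refer to the continuous representative. $K_1$ is the interpolation constant for degree $1$ (known result): for every $T\in\triangle$ and $f\in W^{2,p}(T)$, the linear polynomial $P_f$ interpolating $f$ at the vertices of $T$ satisfies $\|f-P_f\|_{p,T}\le K_1|T|^2|f|_{2,p,T}$; $K_1$ is absolute if $p=\infty$ and depends on the shape parameters $\kappa_T$ if $1\le p<\infty$.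 $C_7$ is the constant, asserted in the paper to depend only on the boundary of $\Omega$, such that $|\#\triangle|^{1-1/p}|\triangle|^2\le C_7|\triangle|^{2/p}$ for $1\le p\le\infty$ (for $p=\infty$ this reads $|\#\triangle|\,|\triangle|^2\le C_7$). *)

theory Defs
  imports "HOL-Probability.Essential_Supremum"
begin

section \<open>Polygons and triangulations\<close>

text \<open>
  A polygon is the closure of a bounded domain (nonempty, open, connected) whose boundary is a
  finite union of line segments.  It need be neither convex nor simply connected.
\<close>

definition polygon :: "(real \<times> real) set \<Rightarrow> bool" where
  "polygon \<Omega> \<longleftrightarrow>
     bounded \<Omega> \<and> interior \<Omega> \<noteq> {} \<and> connected (interior \<Omega>) \<and> closure (interior \<Omega>) = \<Omega> \<and>
     (\<exists>E. finite E \<and> frontier \<Omega> = (\<Union>(a, b)\<in>E. closed_segment a b))"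

text \<open>The boundary points near which the boundary is not a straight line.\<close>

definition polygon_vertices :: "(real \<times> real) set \<Rightarrow> (real \<times> real) set" where
  "polygon_vertices \<Omega> =
     {z \<in> frontier \<Omega>. \<not> (\<exists>e>0. \<exists>v. v \<noteq> 0 \<and>
        frontier \<Omega> \<inter> ball z e = range (\<lambda>t. z + t *\<^sub>R v) \<inter> ball z e)}"

definition triangle_vertices :: "(real \<times> real) set \<Rightarrow> (real \<times> real) set" where
  "triangle_vertices T = {v. v extreme_point_of T}"

text \<open>
  By the library notion \<^const>\<open>triangulation\<close>, a triangulation is finite and any two of its members
  meet in a common face.  For distinct (nondegenerate, closed) triangles this means that they
  are disjoint or meet in exactly one common vertex or one common edge.
\<close>

definition triangulation_of :: "(real \<times> real) set set \<Rightarrow> (real \<times> real) set \<Rightarrow> bool" where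
  "triangulation_of \<T> \<Omega> \<longleftrightarrow> triangulation \<T> \<and> (\<forall>T\<in>\<T>. 2 simplex T) \<and> \<Union>\<T> = \<Omega>"

definition generated_from :: "(real \<times> real) set set \<Rightarrow> (real \<times> real) set \<Rightarrow> bool" where
  "generated_from \<T> V \<longleftrightarrow> (\<Union>T\<in>\<T>. triangle_vertices T) = V"

abbreviation area :: "(real \<times> real) set \<Rightarrow> real" where
  "area T \<equiv> measure lebesgue T"

text \<open>Any two distinct vertices of a triangle span an edge; pairs \<open>v = w\<close> contribute only 0.\<close>

definition longest_edge :: "(real \<times> real) set \<Rightarrow> real" where
  "longest_edge T = Max {dist v w | v w. v \<in> triangle_vertices T \<and> w \<in> triangle_vertices T}"

definition mesh_size :: "(real \<times> real) set set \<Rightarrow> real" where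
  "mesh_size \<T> = Max (longest_edge ` \<T>)"

definition quad_weight :: "(real \<times> real) set set \<Rightarrow> real \<times> real \<Rightarrow> real" where
  "quad_weight \<T> z = (\<Sum>T | T \<in> \<T> \<and> z \<in> T. area T / 3)"

text \<open>Bivariate polynomials of degree at most 1, as functions.\<close>

definition linear_polys :: "(real \<times> real \<Rightarrow> real) set" where
  "linear_polys = {P. \<exists>a b c. P = (\<lambda>(x, y). a + b * x + c * y)}"


section \<open>Weak derivatives and Sobolev spaces\<close>

definition partial_x :: "(real \<times> real \<Rightarrow> real) \<Rightarrow> real \<times> real \<Rightarrow> real" where
  "partial_x \<phi> = (\<lambda>(x, y). deriv (\<lambda>t. \<phi> (t, y)) x)"

definition partial_y :: "(real \<times> real \<Rightarrow> real) \<Rightarrow> real \<times> real \<Rightarrow> real" where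
  "partial_y \<phi> = (\<lambda>(x, y). deriv (\<lambda>t. \<phi> (x, t)) y)"

primrec cont_diff :: "nat \<Rightarrow> (real \<times> real \<Rightarrow> real) \<Rightarrow> bool" where
  "cont_diff 0 \<phi> \<longleftrightarrow> continuous_on UNIV \<phi>"
| "cont_diff (Suc n) \<phi> \<longleftrightarrow>
     \<phi> differentiable_on UNIV \<and> cont_diff n (partial_x \<phi>) \<and> cont_diff n (partial_y \<phi>)"

text \<open>The space \<open>C\<^sub>c\<^sup>\<infinity>(U)\<close>, extended by zero to the plane.\<close>

definition test_functions :: "(real \<times> real) set \<Rightarrow> (real \<times> real \<Rightarrow> real) set" where
  "test_functions U =
     {\<phi>. (\<forall>n. cont_diff n \<phi>) \<and> compact (closure {z. \<phi> z \<noteq> 0}) \<and> closure {z. \<phi> z \<noteq> 0} \<subseteq> U}"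

definition loc_integrable :: "(real \<times> real) set \<Rightarrow> (real \<times> real \<Rightarrow> real) \<Rightarrow> bool" where
  "loc_integrable U f \<longleftrightarrow> (\<forall>K. compact K \<and> K \<subseteq> U \<longrightarrow> integrable (lebesgue_on K) f)"

text \<open>\<open>g\<close> is a version of the weak derivative \<open>D\<^sub>x\<^sup>\<nu> D\<^sub>y\<^sup>\<mu> f\<close> on the open set \<open>U\<close>.\<close>

definition has_weak_deriv ::
  "nat \<Rightarrow> nat \<Rightarrow> (real \<times> real) set \<Rightarrow> (real \<times> real \<Rightarrow> real) \<Rightarrow> (real \<times> real \<Rightarrow> real) \<Rightarrow> bool" where
  "has_weak_deriv \<nu> \<mu> U f g \<longleftrightarrow>
     loc_integrable U f \<and> loc_integrable U g \<and>
     (\<forall>\<phi>\<in>test_functions U.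
        (LINT z|lebesgue_on U. f z * (partial_x ^^ \<nu>) ((partial_y ^^ \<mu>) \<phi>) z)
        = (-1) ^ (\<nu> + \<mu>) * (LINT z|lebesgue_on U. g z * \<phi> z))"

text \<open>The weak derivative is determined up to null sets; norms do not depend on the choice.\<close>

definition weak_deriv ::
  "nat \<Rightarrow> nat \<Rightarrow> (real \<times> real) set \<Rightarrow> (real \<times> real \<Rightarrow> real) \<Rightarrow> real \<times> real \<Rightarrow> real" where
  "weak_deriv \<nu> \<mu> U f = (SOME g. has_weak_deriv \<nu> \<mu> U f g)"

text \<open>
  Exponents \<open>1 \<le> p \<le> \<infinity>\<close> have type \<^typ>\<open>ennreal\<close>, where \<open>1 / \<infinity> = 0\<close>.  The norms are real-valued
  and meaningful for members of \<open>Lp_space\<close> resp. \<open>sobolev_space\<close>.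
\<close>

definition Lp_space :: "ennreal \<Rightarrow> (real \<times> real) set \<Rightarrow> (real \<times> real \<Rightarrow> real) set" where
  "Lp_space p U =
     {g \<in> borel_measurable (lebesgue_on U).
        if p = \<infinity> then esssup (lebesgue_on U) (\<lambda>z. ereal \<bar>g z\<bar>) < \<infinity>
        else integrable (lebesgue_on U) (\<lambda>z. \<bar>g z\<bar> powr enn2real p)}"

definition Lp_norm :: "ennreal \<Rightarrow> (real \<times> real) set \<Rightarrow> (real \<times> real \<Rightarrow> real) \<Rightarrow> real" where
  "Lp_norm p U g =
     (if p = \<infinity> then real_of_ereal (esssup (lebesgue_on U) (\<lambda>z. ereal \<bar>g z\<bar>))
      else (LINT z|lebesgue_on U. \<bar>g z\<bar> powr enn2real p) powr (1 / enn2real p))"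

definition sobolev_space :: "nat \<Rightarrow> ennreal \<Rightarrow> (real \<times> real) set \<Rightarrow> (real \<times> real \<Rightarrow> real) set" where
  "sobolev_space k p U =
     {f \<in> Lp_space p U. \<forall>\<nu> \<mu>. \<nu> + \<mu> \<le> k \<longrightarrow> (\<exists>g\<in>Lp_space p U. has_weak_deriv \<nu> \<mu> U f g)}"

definition sobolev_seminorm ::
  "nat \<Rightarrow> ennreal \<Rightarrow> (real \<times> real) set \<Rightarrow> (real \<times> real \<Rightarrow> real) \<Rightarrow> real" where
  "sobolev_seminorm k p U f =
     (if p = \<infinity> then Max {Lp_norm p U (weak_deriv \<nu> \<mu> U f) | \<nu> \<mu>. \<nu> + \<mu> = k}
      else (\<Sum>(\<nu>, \<mu>) | \<nu> + \<mu> = k. Lp_norm p U (weak_deriv \<nu> \<mu> U f) powr enn2real p)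
             powr (1 / enn2real p))"


section \<open>The constants in the error bound\<close>

text \<open>
  Sobolev functions on a closed region \<open>S\<close> live on the open set \<open>interior S\<close>; requiring in addition
  continuity on \<open>S\<close> selects the continuous representative, so that values at vertices make sense.
\<close>

definition interpolation_const :: "ennreal \<Rightarrow> (real \<times> real) set set \<Rightarrow> real \<Rightarrow> bool" where
  "interpolation_const p \<T> K \<longleftrightarrow>
     (\<forall>T\<in>\<T>. \<forall>f. f \<in> sobolev_space 2 p (interior T) \<and> continuous_on T f \<longrightarrow>
        (\<forall>P\<in>linear_polys. (\<forall>v\<in>triangle_vertices T. P v = f v) \<longrightarrow>
           Lp_norm p T (\<lambda>z. f z - P z)
           \<le> K * longest_edge T ^ 2 * sobolev_seminorm 2 p (interior T) f))"

text \<open>A single constant for all exponents; at \<open>r = \<infinity>\<close> the bound reads \<open>#\<T> * |\<T>|\<^sup>2 \<le> C\<close>.\<close>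

definition mesh_count_const :: "(real \<times> real) set set \<Rightarrow> real \<Rightarrow> bool" where
  "mesh_count_const \<T> C \<longleftrightarrow>
     (\<forall>r::ennreal. 1 \<le> r \<longrightarrow>
        real (card \<T>) powr (1 - enn2real (1 / r)) * mesh_size \<T> ^ 2
        \<le> C * mesh_size \<T> powr (2 * enn2real (1 / r)))"

end

theory Submission
  imports Defs
begin

text \<open>
  On a triangle a linear polynomial integrates to a third of the area times the sum of its vertex
  values, so the quadrature rule integrates the piecewise linear interpolant of \<open>f\<close> exactly.  On
  each triangle \<open>T\<close> the error is therefore \<open>\<integral>\<^sub>T (f - P\<^sub>f)\<close>, which Hoelder's inequality and the
  interpolation bound estimate by \<open>A\<^sub>T\<^bsup>1/q\<^esup> K\<^sub>1 |T|\<^sup>2 |f|\<^bsub>2,p,T\<^esub>\<close>.  Since \<open>|f|\<^bsub>2,p,T\<^esub> \<le> |f|\<^bsub>2,p,\<Omega>\<^esub>\<close>,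
  summation yields the factor \<open>#\<T> |\<T>|\<^sup>2 \<le> C\<^sub>7\<close>.  Comparing the two seminorms requires weak
  derivatives to be unique almost everywhere, because \<open>weak_deriv\<close> makes an independent choice on
  each domain.
\<close>

section \<open>Smooth bump functions\<close>

text \<open>A weak derivative is known only through its integrals against test functions, so two
  versions of it can be told equal only if test functions are plentiful. Products of four copies of
  exp(-1/t), one for each side of a box, are smooth and can be scaled so as to converge pointwise to
  the indicator of the open box. Dominated convergence then shows that the difference of two
  versions has integral 0 over boxes, and boxes are an intersection-stable generator of the Borel
  sets, which forces the difference to vanish almost everywhere.

  Exactness on one triangle is a matter of symmetry: its barycentric coordinates all have the same
  integral and sum to 1, so each integrates to a third of the area. The argument works for simplices
  of every dimension, and no integral has to be evaluated.\<close>

definition exp_recip :: "real poly \<Rightarrow> real \<Rightarrow> real" where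
  "exp_recip P t = (if t > 0 then poly P (1 / t) * exp (- (1 / t)) else 0)"

lemma exp_recip_mult: "c * exp_recip P t = exp_recip (smult c P) t"
  by (simp add: exp_recip_def)

text \<open>On the left the function is constantly 0; on the right the substitution s = 1/t leads to
  P(s) / exp s at infinity, where the exponential beats every monomial.\<close>

lemma exp_recip_tendsto_0: "(exp_recip P \<longlongrightarrow> 0) (at 0)"
proof (rule filterlim_split_at)
  show "(exp_recip P \<longlongrightarrow> 0) (at_left 0)"
    by (rule tendsto_eventually) (auto simp: eventually_at_left_field exp_recip_def intro!: exI[of _ "-1"])
  have *: "((\<lambda>s. poly P s / exp s) \<longlongrightarrow> 0) at_top"
  proof -
    have "((\<lambda>s. \<Sum>i\<le>degree P. coeff P i * (s ^ i / exp s)) \<longlongrightarrow> (\<Sum>i\<le>degree P. coeff P i * 0)) at_top"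
      by (intro tendsto_sum tendsto_mult tendsto_const tendsto_power_div_exp_0)
    then show ?thesis
      by (simp add: poly_altdef sum_divide_distrib)
  qed
  have "((\<lambda>t. poly P (inverse t) / exp (inverse t)) \<longlongrightarrow> 0) (at_right 0)"
    by (rule filterlim_compose[OF * filterlim_inverse_at_top_right])
  then show "(exp_recip P \<longlongrightarrow> 0) (at_right 0)"
    by (rule Lim_transform_eventually)
       (auto simp: eventually_at_right_field exp_recip_def exp_minus field_simps intro!: exI[of _ 1])
qed

text \<open>The chain rule sends P(1/t) exp(-1/t) to (1/t)^2 (P - P')(1/t) exp(-1/t), so the family
  is closed under differentiation. This is why it carries an arbitrary polynomial although the bumps
  use only P = 1.\<close>

lemma exp_recip_has_derivative:
  "(exp_recip P has_real_derivative exp_recip ([:0, 0, 1:] * (P - pderiv P)) t) (at t)"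
proof (cases t "0 :: real" rule: linorder_cases)
  case less
  have "((\<lambda>t. 0) has_real_derivative 0) (at t)" by simp
  then have "(exp_recip P has_real_derivative 0) (at t)"
    by (rule has_field_derivative_transform_within_open[where S = "{..<0}"])
       (use less in \<open>auto simp: exp_recip_def\<close>)
  then show ?thesis using less by (simp add: exp_recip_def)
next
  case equal
  \<comment> \<open>Dividing by h multiplies the polynomial in 1/h by its variable, so the
    difference quotient at 0 is again in the family and tends to 0.\<close>
  have "(\<lambda>h. (exp_recip P (0 + h) - exp_recip P 0) / h) = exp_recip ([:0, 1:] * P)"
    by (rule ext) (simp add: exp_recip_def)
  then show ?thesis using equal exp_recip_tendsto_0[of "[:0, 1:] * P"]
    by (simp add: DERIV_def exp_recip_def)
next
  case greater
  have "((\<lambda>t. poly P (1 / t) * exp (- (1 / t))) has_real_derivative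
        poly ([:0, 0, 1:] * (P - pderiv P)) (1 / t) * exp (- (1 / t))) (at t)"
    using greater
    by (auto intro!: derivative_eq_intros DERIV_chain2[OF poly_DERIV]
        simp: field_simps power2_eq_square)
  then have "(exp_recip P has_real_derivative
        poly ([:0, 0, 1:] * (P - pderiv P)) (1 / t) * exp (- (1 / t))) (at t)"
    by (rule has_field_derivative_transform_within_open[where S = "{0<..}"])
       (use greater in \<open>auto simp: exp_recip_def\<close>)
  then show ?thesis using greater by (simp add: exp_recip_def)
qed

section \<open>Partial derivatives and closure properties of C^k functions\<close>

lemma differentiable_slice_x:
  "\<phi> differentiable at (x, y) \<Longrightarrow> (\<lambda>t. \<phi> (t, y)) differentiable at (x :: real)"
  for \<phi> :: "real \<times> real \<Rightarrow> real"
  by (rule differentiable_chain_at[where f = "\<lambda>t. (t, y)" and g = \<phi>, unfolded o_def])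
     (auto simp: differentiable_def intro!: exI derivative_intros)

lemma differentiable_slice_y:
  "\<phi> differentiable at (x, y) \<Longrightarrow> (\<lambda>t. \<phi> (x, t)) differentiable at (y :: real)"
  for \<phi> :: "real \<times> real \<Rightarrow> real"
  by (rule differentiable_chain_at[where f = "\<lambda>t. (x, t)" and g = \<phi>, unfolded o_def])
     (auto simp: differentiable_def intro!: exI derivative_intros)

lemma partial_x_has_derivative:
  assumes "\<phi> differentiable_on UNIV"
  shows "((\<lambda>t. \<phi> (t, y)) has_real_derivative partial_x \<phi> (x, y)) (at x)"
  using differentiable_slice_x[of \<phi> x y] assms
  by (simp add: partial_x_def differentiable_on_def DERIV_deriv_iff_real_differentiable)

lemma partial_y_has_derivative:
  assumes "\<phi> differentiable_on UNIV"
  shows "((\<lambda>t. \<phi> (x, t)) has_real_derivative partial_y \<phi> (x, y)) (at y)"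
  using differentiable_slice_y[of \<phi> x y] assms
  by (simp add: partial_y_def differentiable_on_def DERIV_deriv_iff_real_differentiable)

lemma partial_x_eqI:
  "(\<And>x y. ((\<lambda>t. \<phi> (t, y)) has_real_derivative D (x, y)) (at x)) \<Longrightarrow> partial_x \<phi> = D"
  by (auto simp: partial_x_def fun_eq_iff intro!: DERIV_imp_deriv)

lemma partial_y_eqI:
  "(\<And>x y. ((\<lambda>t. \<phi> (x, t)) has_real_derivative D (x, y)) (at y)) \<Longrightarrow> partial_y \<phi> = D"
  by (auto simp: partial_y_def fun_eq_iff intro!: DERIV_imp_deriv)

text \<open>Needed for the product rule, where the undifferentiated factors reappear one order
  lower.\<close>

lemma cont_diff_SucD: "cont_diff (Suc n) \<phi> \<Longrightarrow> cont_diff n \<phi>"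
proof (induction n arbitrary: \<phi>)
  case (Suc n)
  have "cont_diff (Suc n) (partial_x \<phi>)" "cont_diff (Suc n) (partial_y \<phi>)"
    using Suc.prems by (simp_all only: cont_diff.simps)
  then have "cont_diff n (partial_x \<phi>)" "cont_diff n (partial_y \<phi>)"
    by (blast intro: Suc.IH)+
  then show ?case using Suc.prems by (simp only: cont_diff.simps)
qed (auto intro: differentiable_imp_continuous_on)

lemma cont_diff_add:
  "cont_diff n \<phi> \<Longrightarrow> cont_diff n \<psi> \<Longrightarrow> cont_diff n (\<lambda>z. \<phi> z + \<psi> z)"
proof (induction n arbitrary: \<phi> \<psi>)
  case (Suc n)
  have "partial_x (\<lambda>z. \<phi> z + \<psi> z) = (\<lambda>z. partial_x \<phi> z + partial_x \<psi> z)"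
    using Suc.prems by (auto intro!: partial_x_eqI derivative_intros partial_x_has_derivative)
  moreover have "partial_y (\<lambda>z. \<phi> z + \<psi> z) = (\<lambda>z. partial_y \<phi> z + partial_y \<psi> z)"
    using Suc.prems by (auto intro!: partial_y_eqI derivative_intros partial_y_has_derivative)
  ultimately show ?case
    using Suc.prems by (simp add: differentiable_on_add Suc.IH)
qed (simp add: continuous_on_add)

lemma cont_diff_mult:
  "cont_diff n \<phi> \<Longrightarrow> cont_diff n \<psi> \<Longrightarrow> cont_diff n (\<lambda>z. \<phi> z * \<psi> z)"
proof (induction n arbitrary: \<phi> \<psi>)
  case (Suc n)
  have "partial_x (\<lambda>z. \<phi> z * \<psi> z) = (\<lambda>z. partial_x \<phi> z * \<psi> z + \<phi> z * partial_x \<psi> z)"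
    using Suc.prems
    by (auto intro!: partial_x_eqI derivative_eq_intros partial_x_has_derivative)
  moreover have "partial_y (\<lambda>z. \<phi> z * \<psi> z) = (\<lambda>z. partial_y \<phi> z * \<psi> z + \<phi> z * partial_y \<psi> z)"
    using Suc.prems
    by (auto intro!: partial_y_eqI derivative_eq_intros partial_y_has_derivative)
  moreover have "cont_diff n \<phi>" "cont_diff n \<psi>"
    using Suc.prems by (blast intro: cont_diff_SucD)+
  ultimately show ?case
    using Suc.prems by (simp add: differentiable_on_mult Suc.IH cont_diff_add)
qed (simp add: continuous_on_mult)

text \<open>Composed with an affine form, the family is closed under both partial derivatives, since
  the inner derivatives \<open>\<alpha>\<close> and \<open>\<beta>\<close> are scalars that the
  polynomial absorbs. Hence the induction is over all \<open>P\<close> at once.\<close>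

lemma cont_diff_exp_recip: "cont_diff n (\<lambda>z. exp_recip P (\<alpha> * fst z + \<beta> * snd z + \<gamma>))"
proof (induction n arbitrary: P)
  case 0

  have "continuous_on UNIV (exp_recip P)"
    by (rule DERIV_continuous_on) (rule has_field_derivative_at_within[OF exp_recip_has_derivative])
  then show ?case
    by (auto intro!: continuous_on_compose2[of UNIV "exp_recip P"] continuous_intros)
next
  case (Suc n)
  let ?f = "\<lambda>z :: real \<times> real. exp_recip P (\<alpha> * fst z + \<beta> * snd z + \<gamma>)"
  let ?Q = "[:0, 0, 1:] * (P - pderiv P)"
  have "(?f has_derivative (\<lambda>h. exp_recip ?Q (\<alpha> * fst z + \<beta> * snd z + \<gamma>) * (\<alpha> * fst h + \<beta> * snd h))) (at z)"
    for z
  proof -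
    have "((\<lambda>z. \<alpha> * fst z + \<beta> * snd z + \<gamma>) has_derivative (\<lambda>h. \<alpha> * fst h + \<beta> * snd h)) (at z)"
      by (auto intro!: derivative_eq_intros)
    from has_derivative_compose[OF this exp_recip_has_derivative[unfolded has_field_derivative_def]]
    show ?thesis .
  qed
  then have "?f differentiable_on UNIV"
    by (auto simp: differentiable_on_def differentiable_def)
  moreover have "partial_x ?f = (\<lambda>z. exp_recip (smult \<alpha> ?Q) (\<alpha> * fst z + \<beta> * snd z + \<gamma>))"
  proof (rule partial_x_eqI)
    fix x y
    have "((\<lambda>t. \<alpha> * t + \<beta> * y + \<gamma>) has_real_derivative \<alpha>) (at x)"
      by (auto intro!: derivative_eq_intros)
    from DERIV_chain2[OF exp_recip_has_derivative this]
    show "((\<lambda>t. ?f (t, y)) has_real_derivative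
        exp_recip (smult \<alpha> ?Q) (\<alpha> * fst (x, y) + \<beta> * snd (x, y) + \<gamma>)) (at x)"
      by (simp only: fst_conv snd_conv mult.commute[of _ \<alpha>] exp_recip_mult)
  qed
  moreover have "partial_y ?f = (\<lambda>z. exp_recip (smult \<beta> ?Q) (\<alpha> * fst z + \<beta> * snd z + \<gamma>))"
  proof (rule partial_y_eqI)
    fix x y
    have "((\<lambda>t. \<alpha> * x + \<beta> * t + \<gamma>) has_real_derivative \<beta>) (at y)"
      by (auto intro!: derivative_eq_intros)
    from DERIV_chain2[OF exp_recip_has_derivative this]
    show "((\<lambda>t. ?f (x, t)) has_real_derivative
        exp_recip (smult \<beta> ?Q) (\<alpha> * fst (x, y) + \<beta> * snd (x, y) + \<gamma>)) (at y)"
      by (simp only: fst_conv snd_conv mult.commute[of _ \<beta>] exp_recip_mult)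
  qed
  ultimately show ?case
    by (simp only: cont_diff.simps Suc.IH simp_thms)
qed

text \<open>Inside the box each factor is exp(-1/((n+1) d)), where d is the distance to one side.
  Scaling by \<open>Suc n\<close> leaves the nonzero set unchanged and drives every factor to 1,
  which approximates the indicator without convolutions; \<open>Suc\<close> keeps the scale positive
  at n = 0.\<close>

definition box_bump :: "real \<times> real \<Rightarrow> real \<times> real \<Rightarrow> nat \<Rightarrow> real \<times> real \<Rightarrow> real" where
  "box_bump a b n z =
     exp_recip 1 (real (Suc n) * (fst z - fst a)) * exp_recip 1 (real (Suc n) * (fst b - fst z)) *
     (exp_recip 1 (real (Suc n) * (snd z - snd a)) * exp_recip 1 (real (Suc n) * (snd b - snd z)))"

lemma cont_diff_box_bump: "cont_diff k (box_bump a b n)"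
proof -
  have "box_bump a b n = (\<lambda>z.
     exp_recip 1 (real (Suc n) * fst z + 0 * snd z + (- real (Suc n) * fst a)) *
     exp_recip 1 (- real (Suc n) * fst z + 0 * snd z + real (Suc n) * fst b) *
     (exp_recip 1 (0 * fst z + real (Suc n) * snd z + (- real (Suc n) * snd a)) *
      exp_recip 1 (0 * fst z + (- real (Suc n)) * snd z + real (Suc n) * snd b)))"
    unfolding box_bump_def by (intro ext) (simp add: algebra_simps)
  then show ?thesis
    by (simp only:) (intro cont_diff_mult cont_diff_exp_recip)
qed

lemma mem_box_prod: "(z \<in> box a b) \<longleftrightarrow> fst a < fst z \<and> fst z < fst b \<and> snd a < snd z \<and> snd z < snd b"
  for z :: "real \<times> real"
  by (auto simp: mem_box Basis_prod_def inner_prod_def)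

lemma box_bump_nonzero_iff: "box_bump a b n z \<noteq> 0 \<longleftrightarrow> z \<in> box a b"
  by (auto simp: box_bump_def exp_recip_def mem_box_prod zero_less_mult_iff)

lemma box_bump_bounds: "0 \<le> box_bump a b n z" "box_bump a b n z \<le> 1"
proof -
  have "0 \<le> exp_recip 1 t" "exp_recip 1 t \<le> 1" for t
    by (auto simp: exp_recip_def)
  then show "0 \<le> box_bump a b n z" "box_bump a b n z \<le> 1"
    by (auto simp: box_bump_def intro!: mult_le_one)
qed

lemma box_bump_test_function:
  assumes "cbox a b \<subseteq> U"
  shows "box_bump a b n \<in> test_functions U"
proof -
  have "closure {z. box_bump a b n z \<noteq> 0} \<subseteq> cbox a b"
    by (rule closure_minimal) (auto simp: box_bump_nonzero_iff box_subset_cbox[THEN subsetD])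
  then show ?thesis
    using assms bounded_subset[OF bounded_cbox]
    by (auto simp: test_functions_def cont_diff_box_bump compact_eq_bounded_closed)
qed

lemma box_bump_tendsto: "(\<lambda>n. box_bump a b n z) \<longlonglongrightarrow> indicator (box a b) z"
proof (cases "z \<in> box a b")
  case True
  have *: "(\<lambda>n. exp_recip 1 (real (Suc n) * d)) \<longlonglongrightarrow> 1" if "d > 0" for d
  proof -
    have "(\<lambda>n. exp (- (1 / real (Suc n)) * (1 / d))) \<longlonglongrightarrow> exp (- 0 * (1 / d))"
      using LIMSEQ_Suc[OF lim_1_over_n] by (intro tendsto_intros) simp
    moreover have "exp_recip 1 (real (Suc n) * d) = exp (- (1 / real (Suc n)) * (1 / d))" for n
      using that by (simp add: exp_recip_def zero_less_mult_iff del: of_nat_Suc)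
    ultimately show ?thesis by simp
  qed
  have "(\<lambda>n. box_bump a b n z) \<longlonglongrightarrow> 1 * 1 * (1 * 1)"
    unfolding box_bump_def
    using True by (intro tendsto_mult *) (auto simp: mem_box_prod)
  then show ?thesis using True by simp
next
  case False
  then have "box_bump a b n z = 0" for n
    using box_bump_nonzero_iff by blast
  then show ?thesis using False by simp
qed

section \<open>Uniqueness of weak derivatives\<close>

lemma box_in_sets_lebesgue [simp]: "box a b \<in> sets lebesgue"
  for a b :: "'a::euclidean_space"
  using lmeasurable_box by (rule fmeasurableD)

text \<open>Dynkin's argument: the sets over which the integral vanishes are closed under
  complements and countable disjoint unions. As boxes generate only the Borel sets, it is run on a
  Borel version \<open>G'\<close> of \<open>G\<close>.\<close>

lemma AE_zero_if_box_integrals_zero: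
  fixes G :: "'a::euclidean_space \<Rightarrow> real"
  assumes G: "integrable lebesgue G" and zero: "\<And>a b. (LINT z:box a b|lebesgue. G z) = 0"
  shows "AE z in lebesgue. G z = 0"
proof -
  obtain G' where G'[measurable]: "G' \<in> borel_measurable lborel" and eq: "AE z in lborel. G z = G' z"
    using completion_ex_borel_measurable_real[OF borel_measurable_integrable[OF G]] by blast
  have "integrable lebesgue G'"
    by (rule integrable_cong_AE_imp[OF G measurable_completion[OF G'] AE_completion[OF eq]])
  then have int: "integrable lborel G'"
    by (simp add: integrable_completion)
  have int_set: "set_integrable lborel S G'" if "S \<in> sets borel" for S
    using int that unfolding set_integrable_def by (intro integrable_mult_indicator) auto
  have box: "(LINT z:box a b|lborel. G' z) = 0" for a b
  proof -
    have "(LINT z:box a b|lborel. G' z) = (LINT z:box a b|lebesgue. G' z)"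
      unfolding set_lebesgue_integral_def by (rule integral_completion[symmetric]) simp
    also have "\<dots> = (LINT z:box a b|lebesgue. G z)"
      unfolding set_lebesgue_integral_def
    proof (rule integral_cong_AE)
      show "AE z in lebesgue. indicat_real (box a b) z *\<^sub>R G' z = indicat_real (box a b) z *\<^sub>R G z"
        using AE_completion[OF eq] by eventually_elim simp
    qed (intro borel_measurable_scaleR borel_measurable_indicator box_in_sets_lebesgue
        measurable_completion[OF G'] borel_measurable_integrable[OF G])+
    finally show ?thesis using zero by simp
  qed
  \<comment> \<open>The complement case of the induction subtracts from the whole space, which is
    not a box but an increasing union of boxes.\<close>
  have UNIV0: "(LINT z:UNIV|lborel. G' z) = 0"
  proof -
    let ?B = "\<lambda>i. box (- (real i *\<^sub>R One)) (real i *\<^sub>R One) :: 'a set"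
    have "(\<lambda>i. LINT z:?B i|lborel. G' z) \<longlonglongrightarrow> (LINT z:(\<Union>i. ?B i)|lborel. G' z)"
      by (rule set_integral_cont_up) (auto intro!: int_set subset_box_imp simp: incseq_def)
    then show ?thesis
      unfolding box UN_box_eq_UNIV by (simp add: LIMSEQ_const_iff)
  qed
  have all: "(LINT z:S|lborel. G' z) = 0" if "S \<in> sets borel" for S
  proof -
    have "Int_stable (range (\<lambda>(a, b). box a b :: 'a set))"
      by (auto simp: Int_stable_def box_Int_box)
    moreover have "range (\<lambda>(a, b). box a b :: 'a set) \<subseteq> Pow UNIV"
      by simp
    moreover have S: "S \<in> sigma_sets UNIV (range (\<lambda>(a, b). box a b :: 'a set))"
      using that by (simp add: borel_eq_box)
    ultimately show ?thesis
    proof (induction rule: sigma_sets_induct_disjoint)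
      case (basic A)
      then show ?case using box by auto
    next
      case empty
      then show ?case by (simp add: set_lebesgue_integral_def)
    next
      case (compl A)
      then have A: "A \<in> sets borel" by (simp add: borel_eq_box)
      have "(LINT z:A \<union> (UNIV - A)|lborel. G' z) = (LINT z:A|lborel. G' z) + (LINT z:UNIV - A|lborel. G' z)"
        using A by (intro set_integral_Un int_set) auto
      then show ?case
        using compl UNIV0 by simp
    next
      case (union A)
      then have A: "A i \<in> sets borel" for i by (auto simp: borel_eq_box)
      have "(LINT z:(\<Union>i. A i)|lborel. G' z) = (\<Sum>i. (LINT z:A i|lborel. G' z))"
        using A union(1)
        by (intro lebesgue_integral_countable_add int_set sets.countable_UN)
           (auto simp: disjoint_family_on_def)
      then show ?case using union by simp
    qed
  qed
  have "AE z in lborel. G' z = 0"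
    by (rule sigma_finite_measure.density_zero[OF sigma_finite_lborel int]) (use all in simp)
  with eq have "AE z in lborel. G z = 0"
    by eventually_elim simp
  then show ?thesis by (rule AE_completion)
qed

text \<open>Dominated convergence along the bumps of the box. As \<open>g\<close> need not be
  integrable on all of \<open>U\<close>, it is cut off to the closed box; the cutoff dominates,
  because bumps take values in [0, 1].\<close>

lemma box_integral_zero:
  assumes sub: "cbox a b \<subseteq> U" and U: "U \<in> sets lebesgue"
    and g: "integrable (lebesgue_on (cbox a b)) g"
    and zero: "\<And>\<phi>. \<phi> \<in> test_functions U \<Longrightarrow> (LINT z|lebesgue_on U. g z * \<phi> z) = 0"
  shows "(LINT z:box a b|lebesgue. g z) = 0"
proof -
  define G where "G = (\<lambda>z. indicator (cbox a b) z * g z)"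
  have G: "integrable lebesgue G"
    using g by (simp add: integrable_restrict_space G_def)
  have Gm: "G \<in> borel_measurable lebesgue"
    using G by (rule borel_measurable_integrable)
  have meas: "box_bump a b n \<in> borel_measurable lebesgue" for n
    using cont_diff_box_bump[of 0 a b n]
    by (simp add: measurable_completion borel_measurable_continuous_onI)
  have "(\<lambda>n. LINT z|lebesgue. G z * box_bump a b n z) \<longlonglongrightarrow>
        (LINT z|lebesgue. G z * indicator (box a b) z)"
  proof (rule integral_dominated_convergence[where w = "\<lambda>z. norm (G z)"])
    show "(\<lambda>z. G z * indicator (box a b) z) \<in> borel_measurable lebesgue"
      by (intro borel_measurable_times Gm borel_measurable_indicator box_in_sets_lebesgue)
    show "(\<lambda>z. G z * box_bump a b n z) \<in> borel_measurable lebesgue" for n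
      by (intro borel_measurable_times Gm meas)
    show "integrable lebesgue (\<lambda>z. norm (G z))"
      using G by (rule integrable_norm)
    show "AE z in lebesgue. (\<lambda>n. G z * box_bump a b n z) \<longlonglongrightarrow> G z * indicator (box a b) z"
      by (intro AE_I2 tendsto_mult tendsto_const box_bump_tendsto)
    show "AE z in lebesgue. norm (G z * box_bump a b n z) \<le> norm (G z)" for n
      by (intro AE_I2) (simp add: abs_mult mult_left_le box_bump_bounds)
  qed
  moreover have "(LINT z|lebesgue. G z * box_bump a b n z) = 0" for n
  proof -
    have eq: "indicat_real U z *\<^sub>R (g z * box_bump a b n z) = G z * box_bump a b n z" for z
      using sub box_bump_nonzero_iff[of a b n z] box_subset_cbox[of a b]
      by (auto simp: G_def indicator_def)
    have "(LINT z|lebesgue_on U. g z * box_bump a b n z) =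
        (LINT z|lebesgue. indicator U z *\<^sub>R (g z * box_bump a b n z))"
      by (rule integral_restrict_space) (use U in simp)
    then show ?thesis
      using zero[OF box_bump_test_function[OF sub, of n]] by (simp only: eq)
  qed
  ultimately have "(LINT z|lebesgue. G z * indicator (box a b) z) = 0"
    by (simp add: LIMSEQ_const_iff)
  moreover have "G z * indicator (box a b) z = indicator (box a b) z *\<^sub>R g z" for z
    using box_subset_cbox[of a b] by (auto simp: G_def indicator_def)
  ultimately show ?thesis
    by (simp add: set_lebesgue_integral_def)
qed

text \<open>An open set is a countable union of closed boxes, so one box at a time suffices, and
  there \<open>g\<close> is integrable. Extended by zero from such a box, \<open>g\<close> has
  vanishing integral over every box of the space, because two boxes meet in a box.\<close>

lemma fundamental_lemma_variations:
  assumes U: "open U" and g: "loc_integrable U g"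
    and zero: "\<And>\<phi>. \<phi> \<in> test_functions U \<Longrightarrow> (LINT z|lebesgue_on U. g z * \<phi> z) = 0"
  shows "AE z in lebesgue_on U. g z = 0"
proof -
  have Um: "U \<in> sets lebesgue"
    using U by auto
  obtain \<D> where \<D>: "countable \<D>" "\<D> \<subseteq> Pow U" "\<And>X. X \<in> \<D> \<Longrightarrow> \<exists>a b. X = cbox a b" "\<Union>\<D> = U"
    by (rule open_countable_Union_open_cbox[OF U]) blast
  have "AE z in lebesgue. z \<in> X \<longrightarrow> g z = 0" if X: "X \<in> \<D>" for X
  proof -
    obtain c d where cd: "X = cbox c d" using \<D> X by blast
    have sub: "cbox c d \<subseteq> U" using \<D> X cd by blast
    have int: "integrable (lebesgue_on K) g" if "compact K" "K \<subseteq> U" for K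
      using g that by (simp add: loc_integrable_def)
    define G where "G = (\<lambda>z. indicator (cbox c d) z * g z)"
    have G: "integrable lebesgue G"
      using int[OF compact_cbox sub] by (simp add: integrable_restrict_space G_def)
    have "(LINT z:box a b|lebesgue. G z) = 0" for a b
    proof -
      obtain a' b' where ab: "box a b \<inter> box c d = box a' b'"
        by (rule that[OF box_Int_box])
      \<comment> \<open>Passing from the closed to the open cutoff costs only the boundary of the
        box, a null set, and makes the region of integration an open box again.\<close>
      have "(LINT z:box a b|lebesgue. G z) = (LINT z:box a b|lebesgue. indicator (box c d) z * g z)"
        unfolding set_lebesgue_integral_def
      proof (rule integral_cong_AE)
        have N: "cbox c d - box c d \<in> null_sets lebesgue"
          using negligible_frontier_interval negligible_iff_null_sets by blast
        have AE: "AE z in lebesgue. indicat_real (box c d) z * g z = G z"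
          using AE_not_in[OF N] by eventually_elim (use box_subset_cbox[of c d] in \<open>auto simp: G_def indicator_def\<close>)
        then show "AE z in lebesgue. indicat_real (box a b) z *\<^sub>R G z =
            indicat_real (box a b) z *\<^sub>R (indicat_real (box c d) z * g z)"
          by eventually_elim simp
        have eq: "indicat_real (box c d) z * g z = indicat_real (box c d) z * G z" for z
          using box_subset_cbox[of c d] by (auto simp: G_def indicator_def)
        show "(\<lambda>z. indicat_real (box a b) z *\<^sub>R (indicat_real (box c d) z * g z)) \<in> borel_measurable lebesgue"
          unfolding eq by (intro borel_measurable_scaleR borel_measurable_times
              borel_measurable_indicator box_in_sets_lebesgue borel_measurable_integrable[OF G])
      qed (intro borel_measurable_scaleR borel_measurable_indicator box_in_sets_lebesgue
          borel_measurable_integrable[OF G])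
      also have "\<dots> = (LINT z:box a' b'|lebesgue. g z)"
        unfolding set_lebesgue_integral_def
        by (rule Bochner_Integration.integral_cong) (auto simp: indicator_def ab[symmetric])
      also have "\<dots> = 0"
      \<comment> \<open>Only for a nonempty open box is the closed box with the same corners its
        closure, and hence contained in \<open>cbox c d\<close>.\<close>
      proof (cases "box a' b' = {}")
        case False
        then have "cbox a' b' = closure (box a' b')"
          by (simp add: closure_box)
        also have "\<dots> \<subseteq> cbox c d"
          by (rule closure_minimal) (use ab box_subset_cbox[of c d] in auto)
        finally have "cbox a' b' \<subseteq> U" using sub by blast
        then show ?thesis
          by (intro box_integral_zero[OF _ Um int[OF compact_cbox] zero])
      qed (simp add: set_lebesgue_integral_def)
      finally show ?thesis .
    qed
    then have "AE z in lebesgue. G z = 0"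
      by (rule AE_zero_if_box_integrals_zero[OF G])
    then show ?thesis
      by eventually_elim (auto simp: G_def cd)
  qed
  then have "AE z in lebesgue. \<forall>X\<in>\<D>. z \<in> X \<longrightarrow> g z = 0"
    by (rule AE_ball_countable') (use \<D>(1) in auto)
  then have "AE z in lebesgue. z \<in> U \<longrightarrow> g z = 0"
    by eventually_elim (use \<D>(4) in blast)
  then show ?thesis
    using Um by (subst AE_restrict_space_iff) auto
qed

section \<open>Restriction of Sobolev functions\<close>

lemma partial_vanish:
  assumes "open V" "\<And>z. z \<in> V \<Longrightarrow> \<phi> z = 0" "z \<in> V"
  shows "partial_x \<phi> z = 0" "partial_y \<phi> z = 0"
proof -
  obtain x y where z: "z = (x, y)" by (cases z)
  have "open ((\<lambda>t. (t, y)) -` V)" "open ((\<lambda>t. (x, t)) -` V)"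
    by (auto intro!: open_vimage assms continuous_intros)
  moreover have "((\<lambda>t. 0 :: real) has_real_derivative 0) (at t)" for t :: real
    by simp
  ultimately have "((\<lambda>t. \<phi> (t, y)) has_real_derivative 0) (at x)"
       "((\<lambda>t. \<phi> (x, t)) has_real_derivative 0) (at y)"
    using assms(2,3) z
    by (auto intro: has_field_derivative_transform_within_open[where f = "\<lambda>_. 0"])
  then show "partial_x \<phi> z = 0" "partial_y \<phi> z = 0"
    by (simp_all add: partial_x_def partial_y_def z DERIV_imp_deriv)
qed

lemma iterated_partial_support:
  assumes "z \<notin> closure {z. \<phi> z \<noteq> 0}"
  shows "(partial_x ^^ \<nu>) ((partial_y ^^ \<mu>) \<phi>) z = 0"
proof -
  let ?V = "- closure {z. \<phi> z \<noteq> 0}"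
  have V: "open ?V" by auto
  have "\<forall>z\<in>?V. (partial_y ^^ \<mu>) \<phi> z = 0"
  proof (induction \<mu>)
    case 0
    show ?case using closure_subset[of "{z. \<phi> z \<noteq> 0}"] by auto
  next
    case (Suc \<mu>)
    then show ?case using partial_vanish(2)[OF V] by simp
  qed
  then have "\<forall>z\<in>?V. (partial_x ^^ \<nu>) ((partial_y ^^ \<mu>) \<phi>) z = 0"
  proof (induction \<nu>)
    case (Suc \<nu>)
    then show ?case using partial_vanish(1)[OF V] by simp
  qed simp
  then show ?thesis using assms by auto
qed

lemma test_functions_mono: "V \<subseteq> U \<Longrightarrow> test_functions V \<subseteq> test_functions U"
  by (auto simp: test_functions_def)

lemma loc_integrable_mono: "V \<subseteq> U \<Longrightarrow> loc_integrable U f \<Longrightarrow> loc_integrable V f"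
  by (auto simp: loc_integrable_def)

lemma integral_lebesgue_on_support:
  fixes F :: "'a::euclidean_space \<Rightarrow> real"
  assumes "V \<subseteq> U" "V \<in> sets lebesgue" "U \<in> sets lebesgue" "\<And>z. z \<notin> V \<Longrightarrow> F z = 0"
  shows "(LINT z|lebesgue_on V. F z) = (LINT z|lebesgue_on U. F z)"
proof -
  have "(LINT z|lebesgue_on V. F z) = (LINT z|lebesgue. indicat_real V z *\<^sub>R F z)"
    using assms(2) by (intro integral_restrict_space) simp
  also have "\<dots> = (LINT z|lebesgue. indicat_real U z *\<^sub>R F z)"
    using assms(1,4) by (intro Bochner_Integration.integral_cong) (auto simp: indicator_def)
  also have "\<dots> = (LINT z|lebesgue_on U. F z)"
    using assms(3) by (intro integral_restrict_space[symmetric]) simp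
  finally show ?thesis .
qed

lemma has_weak_derivD:
  assumes "has_weak_deriv \<nu> \<mu> U f g" "\<phi> \<in> test_functions U"
  shows "(LINT z|lebesgue_on U. f z * (partial_x ^^ \<nu>) ((partial_y ^^ \<mu>) \<phi>) z)
        = (-1) ^ (\<nu> + \<mu>) * (LINT z|lebesgue_on U. g z * \<phi> z)"
  using assms(1) unfolding has_weak_deriv_def by (elim conjE) (rule bspec[OF _ assms(2)])

text \<open>Test functions are already extended by zero, so one for \<open>V\<close> is also one for
  \<open>U\<close>. It vanishes off \<open>V\<close> together with its derivatives, hence the
  integrals over \<open>U\<close> and \<open>V\<close> agree and the same \<open>g\<close>
  serves.\<close>

lemma has_weak_deriv_restrict:
  assumes VU: "V \<subseteq> U" and V: "open V" and U: "open U" and g: "has_weak_deriv \<nu> \<mu> U f g"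
  shows "has_weak_deriv \<nu> \<mu> V f g"
  unfolding has_weak_deriv_def
proof (intro conjI ballI)
  show "loc_integrable V f" "loc_integrable V g"
    using g loc_integrable_mono[OF VU] by (auto simp: has_weak_deriv_def)
  fix \<phi> assume \<phi>: "\<phi> \<in> test_functions V"
  have meas: "V \<in> sets lebesgue" "U \<in> sets lebesgue"
    using U V by auto
  have out: "z \<notin> closure {z. \<phi> z \<noteq> 0}" if "z \<notin> V" for z
    using \<phi> that by (auto simp: test_functions_def)
  have "(LINT z|lebesgue_on V. f z * (partial_x ^^ \<nu>) ((partial_y ^^ \<mu>) \<phi>) z) =
        (LINT z|lebesgue_on U. f z * (partial_x ^^ \<nu>) ((partial_y ^^ \<mu>) \<phi>) z)"
    by (rule integral_lebesgue_on_support[OF VU meas]) (simp add: iterated_partial_support out)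
  moreover have "(LINT z|lebesgue_on V. g z * \<phi> z) = (LINT z|lebesgue_on U. g z * \<phi> z)"
  proof (rule integral_lebesgue_on_support[OF VU meas])
    show "g z * \<phi> z = 0" if "z \<notin> V" for z
      using out[OF that] closure_subset[of "{z. \<phi> z \<noteq> 0}"] by auto
  qed
  ultimately show "(LINT z|lebesgue_on V. f z * (partial_x ^^ \<nu>) ((partial_y ^^ \<mu>) \<phi>) z) =
     (-1) ^ (\<nu> + \<mu>) * (LINT z|lebesgue_on V. g z * \<phi> z)"
    using has_weak_derivD[OF g subsetD[OF test_functions_mono[OF VU] \<phi>]] by (simp only:)
qed

text \<open>On the compact support \<open>g\<close> is integrable and the test function bounded.
  Uniqueness needs this to split the integral of a difference.\<close>

lemma integrable_mult_test_function:
  assumes U: "open U" and g: "loc_integrable U g" and \<phi>: "\<phi> \<in> test_functions U"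
  shows "integrable (lebesgue_on U) (\<lambda>z. g z * \<phi> z)"
proof -
  define K where "K = closure {z. \<phi> z \<noteq> 0}"
  have K: "compact K" "K \<subseteq> U" and cont: "continuous_on UNIV \<phi>"
    using \<phi> cont_diff.simps(1) by (auto simp: test_functions_def K_def simp del: cont_diff.simps)
  have Um: "U \<in> sets lebesgue" and Km: "K \<in> sets lebesgue"
    using U K(1) by (auto intro: lmeasurable_compact fmeasurableD)
  obtain B where B: "\<And>z. z \<in> K \<Longrightarrow> norm (\<phi> z) \<le> B"
    using compact_imp_bounded[OF compact_continuous_image[OF continuous_on_subset[OF cont] K(1)]]
    by (auto simp: bounded_iff)
  have gK: "integrable lebesgue (\<lambda>z. indicator K z *\<^sub>R g z)"
    using g K Km by (subst integrable_restrict_space[symmetric]) (auto simp: loc_integrable_def)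
  have "integrable lebesgue (\<lambda>z. (indicator K z *\<^sub>R g z) * \<phi> z)"
  proof (rule Bochner_Integration.integrable_bound)
    show "integrable lebesgue (\<lambda>z. B * (indicator K z *\<^sub>R g z))"
      by (rule integrable_mult_right) (rule gK)
    show "(\<lambda>z. (indicator K z *\<^sub>R g z) * \<phi> z) \<in> borel_measurable lebesgue"
      using cont by (intro borel_measurable_times borel_measurable_integrable[OF gK])
        (simp add: measurable_completion borel_measurable_continuous_onI)
    have "norm ((indicator K z *\<^sub>R g z) * \<phi> z) \<le> norm (B * (indicator K z *\<^sub>R g z))" for z
    proof (cases "z \<in> K")
      case True
      then have "\<bar>\<phi> z\<bar> \<le> \<bar>B\<bar>" using B[of z] by simp
      then show ?thesis
        using True by (simp add: abs_mult mult.commute[of "\<bar>B\<bar>"] mult_left_mono)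
    qed simp
    then show "AE z in lebesgue. norm ((indicator K z *\<^sub>R g z) * \<phi> z) \<le> norm (B * (indicator K z *\<^sub>R g z))"
      by (rule AE_I2)
  qed
  moreover have "(\<lambda>z. (indicator K z *\<^sub>R g z) * \<phi> z) = (\<lambda>z. indicator U z *\<^sub>R (g z * \<phi> z))"
    using K(2) closure_subset[of "{z. \<phi> z \<noteq> 0}"] by (auto simp: K_def indicator_def fun_eq_iff)
  ultimately show ?thesis
    using Um by (subst integrable_restrict_space) auto
qed

lemma has_weak_deriv_unique:
  assumes U: "open U" and g: "has_weak_deriv \<nu> \<mu> U f g" and h: "has_weak_deriv \<nu> \<mu> U f h"
  shows "AE z in lebesgue_on U. g z = h z"
proof -
  have loc: "loc_integrable U g" "loc_integrable U h"
    using g h by (auto simp: has_weak_deriv_def)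
  have "AE z in lebesgue_on U. g z - h z = 0"
  proof (rule fundamental_lemma_variations[OF U])
    show "loc_integrable U (\<lambda>z. g z - h z)"
      using loc by (auto simp: loc_integrable_def)
    fix \<phi> assume \<phi>: "\<phi> \<in> test_functions U"
    have "(-1) ^ (\<nu> + \<mu>) * (LINT z|lebesgue_on U. g z * \<phi> z) = (-1) ^ (\<nu> + \<mu>) * (LINT z|lebesgue_on U. h z * \<phi> z)"
      using has_weak_derivD[OF g \<phi>] has_weak_derivD[OF h \<phi>] by (rule trans[OF sym])
    then have "(LINT z|lebesgue_on U. g z * \<phi> z) = (LINT z|lebesgue_on U. h z * \<phi> z)"
      by simp
    then show "(LINT z|lebesgue_on U. (g z - h z) * \<phi> z) = 0"
      using integrable_mult_test_function[OF U loc(1) \<phi>] integrable_mult_test_function[OF U loc(2) \<phi>]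
      by (simp add: left_diff_distrib)
  qed
  then show ?thesis by simp
qed

section \<open>L^p norms under changes on null sets and under shrinking of the domain\<close>

lemma measurable_lebesgue_on_AE_cong:
  fixes g h :: "'a::euclidean_space \<Rightarrow> real"
  assumes U: "U \<in> sets lebesgue" and g: "g \<in> borel_measurable (lebesgue_on U)"
    and eq: "AE z in lebesgue_on U. g z = h z"
  shows "h \<in> borel_measurable (lebesgue_on U)"
proof (rule borel_measurableI_greater)
  fix a
  let ?G = "{z \<in> space (lebesgue_on U). a < g z}" and ?H = "{z \<in> space (lebesgue_on U). a < h z}"
  have sets_on: "A \<in> sets (lebesgue_on U) \<longleftrightarrow> A \<in> sets lebesgue" if "A \<subseteq> U" for A
    using U that by (subst sets_restrict_space_iff) auto
  have "AE z in lebesgue. z \<in> U \<longrightarrow> g z = h z"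
    using eq U by (subst (asm) AE_restrict_space_iff) auto
  then have "AE z in lebesgue. z \<in> ?G \<longleftrightarrow> z \<in> ?H"
    by eventually_elim auto
  moreover have "?G \<in> sets lebesgue"
    using g by (subst sets_on[symmetric]) (auto simp: borel_measurable_iff_greater)
  ultimately have "?H \<in> sets lebesgue"
    \<comment> \<open>The level sets of \<open>g\<close> and \<open>h\<close> differ by a null set,
      and Lebesgue measure is complete.\<close>
    by (rule completion.in_sets_AE) simp
  then show "?H \<in> sets (lebesgue_on U)"
    by (subst sets_on) auto
qed

lemma Lp_norm_AE_cong:
  assumes "U \<in> sets lebesgue" "g \<in> borel_measurable (lebesgue_on U)" "AE z in lebesgue_on U. g z = h z"
  shows "Lp_norm p U g = Lp_norm p U h"
proof -
  note g [measurable] = assms(2)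
  have h [measurable]: "h \<in> borel_measurable (lebesgue_on U)"
    by (rule measurable_lebesgue_on_AE_cong[OF assms])
  have "esssup (lebesgue_on U) (\<lambda>z. ereal \<bar>g z\<bar>) = esssup (lebesgue_on U) (\<lambda>z. ereal \<bar>h z\<bar>)"
    using assms(3) by (intro esssup_AE_cong) (auto elim: eventually_mono)
  moreover have "(LINT z|lebesgue_on U. \<bar>g z\<bar> powr s) = (LINT z|lebesgue_on U. \<bar>h z\<bar> powr s)" for s
    using assms(3) by (intro integral_cong_AE) (auto elim: eventually_mono)
  ultimately show ?thesis
    by (simp add: Lp_norm_def)
qed

lemma Lp_norm_nonneg: "0 \<le> Lp_norm p U g" if "g \<in> borel_measurable (lebesgue_on U)"
\<comment> \<open>On a domain of measure 0 the essential supremum is minus infinity, not a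
  nonnegative number; \<open>real_of_ereal\<close> turns it into 0.\<close>
proof (cases "p = \<infinity> \<and> emeasure (lebesgue_on U) (space (lebesgue_on U)) \<noteq> 0")
  case True
  then have "esssup (lebesgue_on U) (\<lambda>z. 0 :: ereal) = 0"
    by (intro esssup_const) simp
  moreover have "esssup (lebesgue_on U) (\<lambda>z. 0) \<le> esssup (lebesgue_on U) (\<lambda>z. ereal \<bar>g z\<bar>)"
    by (rule esssup_mono) auto
  ultimately show ?thesis
    using True by (simp add: Lp_norm_def real_of_ereal_pos)
next
  case False
  then show ?thesis
    using that by (auto simp: Lp_norm_def esssup_zero_space)
qed

lemma Lp_restrict:
  assumes VU: "V \<subseteq> U" and V: "V \<in> sets lebesgue" and U: "U \<in> sets lebesgue" and g: "g \<in> Lp_space p U"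
  shows "g \<in> Lp_space p V" "Lp_norm p V g \<le> Lp_norm p U g"
proof -
  have gU[measurable]: "g \<in> borel_measurable (lebesgue_on U)"
    using g by (simp add: Lp_space_def)
  have gV[measurable]: "g \<in> borel_measurable (lebesgue_on V)"
    by (rule measurable_restrict_mono[OF gU VU])
  have "g \<in> Lp_space p V \<and> Lp_norm p V g \<le> Lp_norm p U g"
  proof (cases "p = \<infinity>")
    case True
    let ?eU = "esssup (lebesgue_on U) (\<lambda>z. ereal \<bar>g z\<bar>)" and ?eV = "esssup (lebesgue_on V) (\<lambda>z. ereal \<bar>g z\<bar>)"
    have "AE z in lebesgue_on U. ereal \<bar>g z\<bar> \<le> ?eU"
      by (rule esssup_AE)
    then have "AE z in lebesgue_on V. ereal \<bar>g z\<bar> \<le> ?eU"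
      using U V VU by (simp add: AE_restrict_space_iff) (auto elim: eventually_mono)
    then have le: "?eV \<le> ?eU"
      by (intro esssup_I) auto
    have fin: "?eU < \<infinity>"
      using g True by (simp add: Lp_space_def)
    have "real_of_ereal ?eV \<le> real_of_ereal ?eU"
    \<comment> \<open>The order survives \<open>real_of_ereal\<close> for nonnegative finite values;
      a negative \<open>?eV\<close>, as for a null set \<open>V\<close>, is treated
      separately.\<close>
    proof (cases "0 \<le> ?eV")
      case True
      then show ?thesis using le fin by (intro real_of_ereal_positive_mono) auto
    next
      case False
      then have "real_of_ereal ?eV \<le> 0"
        by (cases ?eV) auto
      also have "0 \<le> real_of_ereal ?eU"
        using Lp_norm_nonneg[OF gU, of \<infinity>] by (simp add: Lp_norm_def)
      finally show ?thesis .
    qed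
    then show ?thesis
      using True le fin gV by (auto simp: Lp_space_def Lp_norm_def)
  next
    case False
    let ?h = "\<lambda>z. \<bar>g z\<bar> powr enn2real p"
    have iU: "integrable lebesgue (\<lambda>z. indicat_real U z *\<^sub>R ?h z)"
      using g False U by (subst integrable_restrict_space[symmetric]) (auto simp: Lp_space_def)
    have "(\<lambda>z. indicat_real V z *\<^sub>R ?h z) = (\<lambda>z. indicat_real V z *\<^sub>R (indicat_real U z *\<^sub>R ?h z))"
      using VU by (auto simp: indicator_def fun_eq_iff)
    then have iV: "integrable lebesgue (\<lambda>z. indicat_real V z *\<^sub>R ?h z)"
      using integrable_mult_indicator[OF V iU] by (simp only:)
    have "(LINT z|lebesgue. indicat_real V z *\<^sub>R ?h z) \<le> (LINT z|lebesgue. indicat_real U z *\<^sub>R ?h z)"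
      using VU by (intro integral_mono iU iV) (auto simp: indicator_def)
    then have "(LINT z|lebesgue_on V. ?h z) \<le> (LINT z|lebesgue_on U. ?h z)"
      using U V by (simp add: integral_restrict_space)
    moreover have "integrable (lebesgue_on V) ?h"
      using iV V by (subst integrable_restrict_space) auto
    ultimately show ?thesis
      using False gV by (auto simp: Lp_space_def Lp_norm_def intro!: powr_mono2 Bochner_Integration.integral_nonneg)
  qed
  then show "g \<in> Lp_space p V" "Lp_norm p V g \<le> Lp_norm p U g"
    by auto
qed

section \<open>Sobolev spaces and seminorms on smaller open sets\<close>

lemma sobolev_space_restrict:
  assumes VU: "V \<subseteq> U" and V: "open V" and U: "open U" and f: "f \<in> sobolev_space k p U"
  shows "f \<in> sobolev_space k p V"
proof -
  have "V \<in> sets lebesgue" "U \<in> sets lebesgue"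
    using U V by auto
  note restrict = Lp_restrict(1)[OF VU this]
  show ?thesis
    unfolding sobolev_space_def
  proof (intro CollectI conjI allI impI)
    show "f \<in> Lp_space p V"
      using f by (intro restrict) (simp add: sobolev_space_def)
    fix \<nu> \<mu> :: nat
    assume "\<nu> + \<mu> \<le> k"
    then obtain g where "g \<in> Lp_space p U" "has_weak_deriv \<nu> \<mu> U f g"
      using f by (auto simp: sobolev_space_def)
    then show "\<exists>g\<in>Lp_space p V. has_weak_deriv \<nu> \<mu> V f g"
      by (intro bexI[of _ g] restrict has_weak_deriv_restrict[OF VU V U])
  qed
qed

lemma Lp_norm_weak_deriv:
  assumes U: "open U" and g: "has_weak_deriv \<nu> \<mu> U f g" "g \<in> borel_measurable (lebesgue_on U)"
  shows "Lp_norm p U (weak_deriv \<nu> \<mu> U f) = Lp_norm p U g"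
proof -
  have "has_weak_deriv \<nu> \<mu> U f (weak_deriv \<nu> \<mu> U f)"
    unfolding weak_deriv_def using g(1) by (rule someI[of "has_weak_deriv \<nu> \<mu> U f"])
  then have "AE z in lebesgue_on U. g z = weak_deriv \<nu> \<mu> U f z"
    by (rule has_weak_deriv_unique[OF U g(1)])
  then show ?thesis
    using U g(2) by (intro Lp_norm_AE_cong[symmetric]) auto
qed

text \<open>The two chosen derivatives are unrelated as functions, but a single \<open>g\<close> is
  a version of the derivative on \<open>U\<close> and on \<open>V\<close>, so both norms become
  norms of \<open>g\<close>.\<close>

lemma Lp_norm_weak_deriv_mono:
  assumes VU: "V \<subseteq> U" and V: "open V" and U: "open U"
    and f: "f \<in> sobolev_space k p U" and le: "\<nu> + \<mu> \<le> k"
  shows "Lp_norm p V (weak_deriv \<nu> \<mu> V f) \<le> Lp_norm p U (weak_deriv \<nu> \<mu> U f)"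
    and "0 \<le> Lp_norm p V (weak_deriv \<nu> \<mu> V f)"
proof -
  have meas: "V \<in> sets lebesgue" "U \<in> sets lebesgue"
    using U V by auto
  obtain g where g: "g \<in> Lp_space p U" "has_weak_deriv \<nu> \<mu> U f g"
    using f le by (auto simp: sobolev_space_def)
  then have m: "g \<in> borel_measurable (lebesgue_on U)"
    by (simp add: Lp_space_def)
  have m': "g \<in> borel_measurable (lebesgue_on V)"
    by (rule measurable_restrict_mono[OF m VU])
  have eq: "Lp_norm p V (weak_deriv \<nu> \<mu> V f) = Lp_norm p V g"
    by (rule Lp_norm_weak_deriv[OF V has_weak_deriv_restrict[OF VU V U g(2)] m'])
  then show "0 \<le> Lp_norm p V (weak_deriv \<nu> \<mu> V f)"
    using Lp_norm_nonneg[OF m'] by simp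
  have "Lp_norm p V g \<le> Lp_norm p U g"
    by (rule Lp_restrict(2)[OF VU meas g(1)])
  then show "Lp_norm p V (weak_deriv \<nu> \<mu> V f) \<le> Lp_norm p U (weak_deriv \<nu> \<mu> U f)"
    using eq Lp_norm_weak_deriv[OF U g(2) m] by simp
qed

lemma finite_nat_sum_eq: "finite {(\<nu>, \<mu>). \<nu> + \<mu> = (k :: nat)}"
  by (rule finite_subset[of _ "{..k} \<times> {..k}"]) auto

lemma sobolev_seminorm_mono:
  assumes VU: "V \<subseteq> U" and V: "open V" and U: "open U" and f: "f \<in> sobolev_space k p U"
  shows "sobolev_seminorm k p V f \<le> sobolev_seminorm k p U f"
proof (cases "p = \<infinity>")
  case True
  let ?N = "\<lambda>W (\<nu>, \<mu>). Lp_norm p W (weak_deriv \<nu> \<mu> W f)" and ?I = "{(\<nu>, \<mu>). \<nu> + \<mu> = k}"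
  have fin: "finite (?N W ` ?I)" for W
    using finite_nat_sum_eq by (rule finite_imageI)
  have img: "{Lp_norm p W (weak_deriv \<nu> \<mu> W f) | \<nu> \<mu>. \<nu> + \<mu> = k} = ?N W ` ?I" for W
    by auto
  have "Max (?N V ` ?I) \<le> Max (?N U ` ?I)"
  proof (rule Max.boundedI[OF fin])
    show "?N V ` ?I \<noteq> {}"
      by (auto intro: exI[of _ 0])
    fix a assume "a \<in> ?N V ` ?I"
    then obtain \<nu> \<mu> where *: "\<nu> + \<mu> = k" "a = ?N V (\<nu>, \<mu>)" by auto
    then have "a \<le> ?N U (\<nu>, \<mu>)"
      using Lp_norm_weak_deriv_mono(1)[OF VU V U f] by simp
    also have "\<dots> \<le> Max (?N U ` ?I)"
      using * by (intro Max_ge[OF fin] imageI) simp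
    finally show "a \<le> Max (?N U ` ?I)" .
  qed
  then show ?thesis
    unfolding sobolev_seminorm_def img using True by (simp only: if_True simp_thms)
next
  case False
  have "(\<Sum>(\<nu>, \<mu>) | \<nu> + \<mu> = k. Lp_norm p V (weak_deriv \<nu> \<mu> V f) powr enn2real p)
     \<le> (\<Sum>(\<nu>, \<mu>) | \<nu> + \<mu> = k. Lp_norm p U (weak_deriv \<nu> \<mu> U f) powr enn2real p)"
    by (intro sum_mono) (auto intro!: powr_mono2 Lp_norm_weak_deriv_mono[OF VU V U f])
  then show ?thesis
    using False by (auto simp: sobolev_seminorm_def intro!: powr_mono2 sum_nonneg)
qed

lemma sobolev_seminorm_nonneg:
  assumes U: "open U" and f: "f \<in> sobolev_space k p U"
  shows "0 \<le> sobolev_seminorm k p U f"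
proof (cases "p = \<infinity>")
  case True
  let ?S = "{Lp_norm p U (weak_deriv \<nu> \<mu> U f) | \<nu> \<mu>. \<nu> + \<mu> = k}"
  have "?S = (\<lambda>(\<nu>, \<mu>). Lp_norm p U (weak_deriv \<nu> \<mu> U f)) ` {(\<nu>, \<mu>). \<nu> + \<mu> = k}"
    by auto
  then have "finite ?S"
    using finite_nat_sum_eq by simp
  moreover have "Lp_norm p U (weak_deriv k 0 U f) \<in> ?S"
    by (intro CollectI exI[of _ k] exI[of _ 0]) simp
  ultimately have "Lp_norm p U (weak_deriv k 0 U f) \<le> Max ?S"
    by (rule Max_ge)
  moreover have "0 \<le> Lp_norm p U (weak_deriv k 0 U f)"
    by (rule Lp_norm_weak_deriv_mono(2)[OF order_refl U U f]) simp
  ultimately show ?thesis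
    using True by (simp add: sobolev_seminorm_def)
qed (simp add: sobolev_seminorm_def)

section \<open>Affine functions on a simplex\<close>

lemma integrable_lebesgue_on_compact:
  fixes f :: "'a::euclidean_space \<Rightarrow> real"
  assumes "compact K" "continuous_on K f"
  shows "integrable (lebesgue_on K) f"
proof -
  have "integrable lborel (\<lambda>z. indicator K z *\<^sub>R f z)"
    using assms by (rule borel_integrable_compact)
  then have "integrable lebesgue (\<lambda>z. indicator K z *\<^sub>R f z)"
    by (subst integrable_completion) (auto dest: borel_measurable_integrable)
  then show ?thesis
    using assms(1) by (subst integrable_restrict_space) (auto intro: fmeasurableD lmeasurable_compact)
qed

text \<open>The differences from one vertex \<open>a\<close> to the others are linearly independent,
  so a linear form can be prescribed on them; the constant then adjusts the value at
  \<open>a\<close>.\<close>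

lemma affine_interpolation:
  fixes C :: "'a::euclidean_space set" and \<phi> :: "'a \<Rightarrow> real"
  assumes C: "\<not> affine_dependent C"
  obtains k l where "linear l" "\<And>v. v \<in> C \<Longrightarrow> k + l v = \<phi> v"
proof (cases "C = {}")
  case True
  show ?thesis
    by (rule that[of "\<lambda>_. 0" 0]) (use True linear_zero in auto)
next
  case False
  then obtain a where a: "a \<in> C" by auto
  then have "independent ((\<lambda>x. - a + x) ` (C - {a}))"
    using C affine_dependent_iff_dependent2 by blast
  then obtain l where l: "linear l" "\<forall>u\<in>(\<lambda>x. - a + x) ` (C - {a}). l u = \<phi> (a + u) - \<phi> a"
    using linear_independent_extend[of _ "\<lambda>u. \<phi> (a + u) - \<phi> a"] by blast
  show ?thesis
  proof (rule that[of l "\<phi> a - l a"])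
    fix v assume "v \<in> C"
    then have "v = a \<or> l (- a + v) = \<phi> v - \<phi> a"
      using l(2) by auto
    then show "\<phi> a - l a + l v = \<phi> v"
      using linear_diff[OF l(1), of v a] by auto
  qed (rule l)
qed

lemma affine_form_convex_combination:
  fixes l :: "'a::real_vector \<Rightarrow> real"
  assumes "linear l" "sum u C = 1"
  shows "k + l (\<Sum>v\<in>C. u v *\<^sub>R v) = (\<Sum>v\<in>C. u v * (k + l v))"
  using assms by (simp add: linear_sum linear_cmul distrib_left sum.distrib flip: sum_distrib_right)

text \<open>The coordinate of \<open>v\<close> is the affine function with value 1 at
  \<open>v\<close> and 0 at the other vertices. The last property reads off coefficients of either
  sign, and the facts about hull points follow from it.\<close>

lemma barycentric_coordinates:
  fixes C :: "'a::euclidean_space set"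
  assumes C: "\<not> affine_dependent C"
  obtains L :: "'a \<Rightarrow> 'a \<Rightarrow> real" where
    "\<And>v. v \<in> C \<Longrightarrow> continuous_on UNIV (L v)"
    "\<And>v z. v \<in> C \<Longrightarrow> z \<in> convex hull C \<Longrightarrow> 0 \<le> L v z"
    "\<And>z. z \<in> convex hull C \<Longrightarrow> (\<Sum>v\<in>C. L v z) = 1"
    "\<And>z. z \<in> convex hull C \<Longrightarrow> (\<Sum>v\<in>C. L v z *\<^sub>R v) = z"
    "\<And>u v. sum u C = 1 \<Longrightarrow> v \<in> C \<Longrightarrow> L v (\<Sum>w\<in>C. u w *\<^sub>R w) = u v"
proof -
  have fin: "finite C"
    using C by (rule aff_independent_finite)
  have "\<exists>k l. linear l \<and> (\<forall>w\<in>C. k + l w = (if w = v then 1 else 0 :: real))" for v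
    by (rule affine_interpolation[OF C, of "\<lambda>w. if w = v then 1 else 0"]) blast
  then obtain k l where kl: "\<And>v. linear (l v)" "\<And>v w. w \<in> C \<Longrightarrow> k v + l v w = (if w = v then 1 else 0 :: real)"
    by metis
  define L where "L v z = k v + l v z" for v z
  have coord: "L v (\<Sum>w\<in>C. u w *\<^sub>R w) = u v" if "sum u C = 1" "v \<in> C" for u v
    unfolding L_def affine_form_convex_combination[OF kl(1) that(1)]
    using that fin by (simp add: kl(2) if_distrib cong: if_cong sum.cong)
  have hull: "\<exists>u. (\<forall>v\<in>C. 0 \<le> u v) \<and> sum u C = 1 \<and> (\<Sum>v\<in>C. u v *\<^sub>R v) = z" if "z \<in> convex hull C" for z
    using that by (simp add: convex_hull_finite[OF fin])
  show ?thesis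
  proof (rule that[of L])
    show "continuous_on UNIV (L v)" for v
      unfolding L_def
      by (intro continuous_intros linear_continuous_on linear_conv_bounded_linear[THEN iffD1] kl(1))
    show "L v (\<Sum>w\<in>C. u w *\<^sub>R w) = u v" if "sum u C = 1" "v \<in> C" for u v
      by (rule coord[OF that])
  next
    fix v z assume v: "v \<in> C" and z: "z \<in> convex hull C"
    obtain u where "\<forall>v\<in>C. 0 \<le> u v" "sum u C = 1" "(\<Sum>v\<in>C. u v *\<^sub>R v) = z"
      using hull[OF z] by blast
    then show "0 \<le> L v z"
      using coord v by metis
  next
    fix z assume z: "z \<in> convex hull C"
    obtain u where u: "\<forall>v\<in>C. 0 \<le> u v" "sum u C = 1" "(\<Sum>v\<in>C. u v *\<^sub>R v) = z"
      using hull[OF z] by blast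
    have "L v z = u v" if "v \<in> C" for v
      using coord[OF u(2) that] u(3) by simp
    then show "(\<Sum>v\<in>C. L v z) = 1" "(\<Sum>v\<in>C. L v z *\<^sub>R v) = z"
      using u by simp_all
  qed
qed

text \<open>By layer-cake integration every barycentric coordinate has the same integral: the part of the
  simplex where the coordinate of \<open>v\<close> is at least \<open>t\<close> is the homothetic image with centre \<open>v\<close> and
  ratio \<open>1 - t\<close>.\<close>

lemma simplex_integral_affine:
  fixes C :: "'a::euclidean_space set" and l :: "'a \<Rightarrow> real"
  assumes C: "\<not> affine_dependent C" "C \<noteq> {}" and l: "linear l"
  shows "(LINT z|lebesgue_on (convex hull C). k + l z) =
    measure lebesgue (convex hull C) / card C * (\<Sum>v\<in>C. k + l v)"
proof -
  define T where "T = convex hull C"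
  have fin: "finite C"
    using C(1) by (rule aff_independent_finite)
  obtain L :: "'a \<Rightarrow> 'a \<Rightarrow> real" where cont: "\<And>v. v \<in> C \<Longrightarrow> continuous_on UNIV (L v)"
    and nonneg: "\<And>v z. v \<in> C \<Longrightarrow> z \<in> T \<Longrightarrow> 0 \<le> L v z"
    and sum1: "\<And>z. z \<in> T \<Longrightarrow> (\<Sum>v\<in>C. L v z) = 1"
    and repr: "\<And>z. z \<in> T \<Longrightarrow> (\<Sum>v\<in>C. L v z *\<^sub>R v) = z"
    and coord: "\<And>u v. sum u C = 1 \<Longrightarrow> v \<in> C \<Longrightarrow> L v (\<Sum>w\<in>C. u w *\<^sub>R w) = u v"
    unfolding T_def by (rule barycentric_coordinates[OF C(1)]) blast
  have T: "compact T" "convex T" "C \<subseteq> T"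
    unfolding T_def by (auto intro: finite_imp_compact_convex_hull fin hull_inc)
  then have Tb [measurable]: "T \<in> sets borel" and Tm: "T \<in> sets lebesgue"
    by (auto simp: borel_compact intro: fmeasurableD lmeasurable_compact)
  have le1: "L v z \<le> 1" if "v \<in> C" "z \<in> T" for v z
    using member_le_sum[of v C "\<lambda>v. L v z"] that nonneg sum1 fin by simp
  have homothety: "{z \<in> T. t \<le> L v z} = (\<lambda>x. (1 - t) *\<^sub>R x + t *\<^sub>R v) ` T"
    if v: "v \<in> C" and t: "0 \<le> t" "t < 1" for v t
  proof (intro equalityI subsetI)
    fix z assume "z \<in> {z \<in> T. t \<le> L v z}"
    then have z: "z \<in> T" "t \<le> L v z" by auto
    \<comment> \<open>The coordinates of the preimage of z: the homothety scales coordinates by 1 -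
      t and adds t at \<open>v\<close>, and \<open>t \<le> L v z\<close> makes the undone coordinate
      at \<open>v\<close> nonnegative.\<close>
    define u where "u w = (L w z - (if w = v then t else 0)) / (1 - t)" for w
    have "0 \<le> u w" if "w \<in> C" for w
      using z nonneg[OF that] t by (simp add: u_def)
    moreover have "sum u C = 1"
      using sum1[OF z(1)] v t fin
      by (simp add: u_def sum_subtractf flip: sum_divide_distrib)
    ultimately have "(\<Sum>w\<in>C. u w *\<^sub>R w) \<in> T"
      unfolding T_def convex_hull_finite[OF fin] by blast
    moreover have "(1 - t) *\<^sub>R (\<Sum>w\<in>C. u w *\<^sub>R w) = (\<Sum>w\<in>C. L w z *\<^sub>R w - (if w = v then t *\<^sub>R w else 0))"
      unfolding scaleR_sum_right using t by (intro sum.cong) (auto simp: u_def scaleR_left_diff_distrib)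
    then have "z = (1 - t) *\<^sub>R (\<Sum>w\<in>C. u w *\<^sub>R w) + t *\<^sub>R v"
      using v fin repr[OF z(1)] by (simp add: sum_subtractf)
    ultimately show "z \<in> (\<lambda>x. (1 - t) *\<^sub>R x + t *\<^sub>R v) ` T"
      by blast
  next
    fix z assume "z \<in> (\<lambda>x. (1 - t) *\<^sub>R x + t *\<^sub>R v) ` T"
    then obtain x where x: "x \<in> T" "z = (1 - t) *\<^sub>R x + t *\<^sub>R v" by auto
    then have "z \<in> T"
      using T v t convexD[OF T(2) x(1), of v "1 - t" t] by auto
    moreover have "t \<le> L v z"
    proof -
      define u where "u w = (1 - t) * L w x + (if w = v then t else 0)" for w
      have "sum u C = 1"
        using sum1[OF x(1)] v fin by (simp add: u_def sum.distrib flip: sum_distrib_left)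
      moreover have "(\<Sum>w\<in>C. u w *\<^sub>R w) = (\<Sum>w\<in>C. (1 - t) *\<^sub>R (L w x *\<^sub>R w) + (if w = v then t *\<^sub>R w else 0))"
        by (intro sum.cong) (auto simp: u_def scaleR_left_distrib)
      then have "(\<Sum>w\<in>C. u w *\<^sub>R w) = z"
        using v fin repr[OF x(1)] x(2)
        by (simp add: sum.distrib del: scaleR_scaleR flip: scaleR_sum_right)
      ultimately have "L v z = u v"
        using coord v by metis
      then show ?thesis
        using nonneg[OF v x(1)] t by (simp add: u_def)
    qed
    ultimately show "z \<in> {z \<in> T. t \<le> L v z}" by simp
  qed
  \<comment> \<open>The common integral of the coordinates, as a formula that does not mention
    \<open>v\<close>. Its value comes out below from summation over the vertices.\<close>
  define c where "c = (\<integral>\<^sup>+ t. indicator {0..<1} t * (ennreal (1 - t) ^ DIM('a) * emeasure lborel T) \<partial>lborel)"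
  have nn: "(\<integral>\<^sup>+ z. indicator T z * ennreal (L v z) \<partial>lborel) = c" if v: "v \<in> C" for v
  proof -
    have [measurable]: "L v \<in> borel_measurable borel"
      by (rule borel_measurable_continuous_onI[OF cont[OF v]])
    let ?S = "\<lambda>z t. indicator T z * indicator {0..L v z} t :: ennreal"
    have "(\<integral>\<^sup>+ z. indicator T z * ennreal (L v z) \<partial>lborel) = (\<integral>\<^sup>+ z. (\<integral>\<^sup>+ t. ?S z t \<partial>lborel) \<partial>lborel)"
    proof (intro nn_integral_cong)
      show "indicator T z * ennreal (L v z) = (\<integral>\<^sup>+ t. ?S z t \<partial>lborel)" for z
        using nonneg[OF v, of z] by (cases "z \<in> T") simp_all
    qed
    also have "\<dots> = (\<integral>\<^sup>+ t. (\<integral>\<^sup>+ z. ?S z t \<partial>lborel) \<partial>lborel)"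
    proof (rule lborel_pair.Fubini'[symmetric])
      have "(\<lambda>(z, t). ?S z t) = (\<lambda>(z, t). indicator T z * (if 0 \<le> t \<and> t \<le> L v z then 1 else 0 :: ennreal))"
        by (auto simp: fun_eq_iff indicator_def)
      then show "(\<lambda>(z, t). ?S z t) \<in> borel_measurable (lborel \<Otimes>\<^sub>M lborel)"
        by simp
    qed
    also have "\<dots> = c"
      unfolding c_def
    proof (rule nn_integral_cong_AE)
      \<comment> \<open>At t = 1 the homothety degenerates; a single level does not affect the
        integral over t.\<close>
      have "AE t in lborel. t \<noteq> (1 :: real)"
        by (rule AE_lborel_singleton)
      then show "AE t in lborel. (\<integral>\<^sup>+ z. ?S z t \<partial>lborel) =
          indicator {0..<1} t * (ennreal (1 - t) ^ DIM('a) * emeasure lborel T)"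
      proof eventually_elim
        case (elim t)
        have "(\<integral>\<^sup>+ z. ?S z t \<partial>lborel) = (\<integral>\<^sup>+ z. indicator {0..} t * indicator {z \<in> T. t \<le> L v z} z \<partial>lborel)"
          by (intro nn_integral_cong) (auto simp: indicator_def)
        also have "\<dots> = indicator {0..} t * emeasure lborel {z \<in> T. t \<le> L v z}"
          by (subst nn_integral_cmult_indicator) (auto simp: pred_def)
        also have "\<dots> = indicator {0..<1} t * (ennreal (1 - t) ^ DIM('a) * emeasure lborel T)"
        proof (cases "0 \<le> t \<and> t < 1")
          case True
          have "emeasure lborel {z \<in> T. t \<le> L v z} = emeasure lebesgue {z \<in> T. t \<le> L v z}"
            by simp
          also have "\<dots> = ennreal (1 - t) ^ DIM('a) * emeasure lebesgue T"
            unfolding homothety[OF v True[THEN conjunct1] True[THEN conjunct2]] 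
            using True by (subst emeasure_lebesgue_affine) (simp add: ennreal_power)
          finally show ?thesis using True by simp
        next
          case False
          then have "t < 0 \<or> {z \<in> T. t \<le> L v z} = {}"
            using le1[OF v] elim by fastforce
          then have "indicator {0..} t * emeasure lborel {z \<in> T. t \<le> L v z} = 0"
            by (elim disjE) (simp, simp only: emeasure_empty mult_zero_right)
          then show ?thesis using False by simp
        qed
        finally show ?case .
      qed
    qed
    finally show ?thesis .
  qed
  have int: "integrable (lebesgue_on T) f" if "continuous_on UNIV f" for f :: "'a \<Rightarrow> real"
    using T(1) that by (intro integrable_lebesgue_on_compact) (auto intro: continuous_on_subset)
  have LL: "(LINT z|lebesgue_on T. L v z) = enn2real c" if v: "v \<in> C" for v
  proof -
    have "(LINT z|lebesgue_on T. L v z) = enn2real (\<integral>\<^sup>+ z. ennreal (L v z) \<partial>lebesgue_on T)"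
      using nonneg[OF v] borel_measurable_integrable[OF int[OF cont[OF v]]]
      by (intro integral_eq_nn_integral AE_I2) auto
    also have "(\<integral>\<^sup>+ z. ennreal (L v z) \<partial>lebesgue_on T) = c"
      using Tm nn[OF v] by (simp add: nn_integral_restrict_space nn_integral_completion mult.commute)
    finally show ?thesis .
  qed
  have "(\<Sum>v\<in>C. (LINT z|lebesgue_on T. L v z)) = (LINT z|lebesgue_on T. (\<Sum>v\<in>C. L v z))"
    by (intro Bochner_Integration.integral_sum[symmetric] int cont)
  also have "\<dots> = (LINT z|lebesgue_on T. 1)"
    by (intro Bochner_Integration.integral_cong) (auto simp: sum1)
  also have "\<dots> = measure lebesgue T"
    using Tm by (simp add: measure_restrict_space)
  \<comment> \<open>The coordinates sum to 1, so \<open>card C\<close> equal integrals add up to the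
    volume.\<close>
  finally have c: "enn2real c = measure lebesgue T / card C"
    using C(2) fin by (simp add: LL field_simps)
  have "(LINT z|lebesgue_on T. k + l z) = (LINT z|lebesgue_on T. (\<Sum>v\<in>C. L v z * (k + l v)))"
  proof (rule Bochner_Integration.integral_cong)
    fix z assume "z \<in> space (lebesgue_on T)"
    then show "k + l z = (\<Sum>v\<in>C. L v z * (k + l v))"
      using affine_form_convex_combination[OF l sum1[of z], of k] repr[of z] by simp
  qed simp
  also have "\<dots> = (\<Sum>v\<in>C. (LINT z|lebesgue_on T. L v z) * (k + l v))"
    by (subst Bochner_Integration.integral_sum) (auto intro: int cont)
  also have "\<dots> = measure lebesgue T / card C * (\<Sum>v\<in>C. k + l v)"
    by (simp add: LL c sum_distrib_left)
  finally show ?thesis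
    unfolding T_def .
qed

section \<open>Hoelder's inequality\<close>

text \<open>The bounds involve q only through 1/q, so q = \<infinity>, which belongs to p = 1, needs
  no separate case.\<close>

lemma enn2real_conjugate:
  assumes "1 \<le> (p :: ennreal)" "1 / p + 1 / q = (1 :: ennreal)"
  shows "p \<noteq> \<infinity> \<Longrightarrow> enn2real (1 / q) = 1 - 1 / enn2real p"
    and "p = \<infinity> \<Longrightarrow> enn2real (1 / q) = 1"
proof -
  assume "p \<noteq> \<infinity>"
  then obtain s where s: "p = ennreal s" "1 \<le> s"
    using assms(1) by (cases p) auto
  have "1 / q \<noteq> \<infinity>"
    using assms(2) by auto
  then obtain r where r: "1 / q = ennreal r" "0 \<le> r"
    by (cases "1 / q") auto
  have "ennreal (1 / s + r) = ennreal 1"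
    using assms(2) s r divide_ennreal[of 1 s] by (simp add: ennreal_plus)
  then have "1 / s + r = 1"
    using s r by (subst (asm) ennreal_inj) auto
  then show "enn2real (1 / q) = 1 - 1 / enn2real p"
    using s r by simp
next
  assume "p = \<infinity>"
  then show "enn2real (1 / q) = 1"
    using assms(2) by simp
qed

text \<open>Young's inequality with weights 1/s and 1 - 1/s for the numbers u^s m^(1-s) and m, whose
  weighted geometric mean is u. The scale m is free, and s = 1 is included.\<close>

lemma Young_scaled:
  fixes u m s :: real
  assumes "0 \<le> u" "0 < m" "1 \<le> s"
  shows "u \<le> u powr s * m powr (1 - s) / s + (1 - 1 / s) * m"
proof (cases "u = 0")
  case False
  then have u: "0 < u" using assms by simp
  have "(u powr s * m powr (1 - s)) powr (1 / s) * m powr (1 - 1 / s) = u"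
  proof -
    have "(u powr s * m powr (1 - s)) powr (1 / s) * m powr (1 - 1 / s) =
          u powr (s * (1 / s)) * m powr ((1 - s) * (1 / s) + (1 - 1 / s))"
      by (simp only: powr_mult powr_powr powr_add mult.assoc)
    also have "\<dots> = u"
      using assms u by (simp add: field_simps)
    finally show ?thesis .
  qed
  then show ?thesis
    using Youngs_inequality_0[of "1 / s" "1 - 1 / s" "u powr s * m powr (1 - s)" m] assms u
    by simp
qed (use assms in simp)

lemma (in finite_measure) Holder_powr:
  fixes g :: "'a \<Rightarrow> real"
  assumes s: "1 \<le> s" and g: "integrable M g" and gs: "integrable M (\<lambda>z. \<bar>g z\<bar> powr s)"
  shows "\<bar>LINT z|M. g z\<bar> \<le> measure M (space M) powr (1 - 1 / s) * (LINT z|M. \<bar>g z\<bar> powr s) powr (1 / s)"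
proof -
  define A where "A = measure M (space M)"
  define I where "I = (LINT z|M. \<bar>g z\<bar> powr s)"
  have I0: "0 \<le> I"
    unfolding I_def by (rule Bochner_Integration.integral_nonneg) simp
  show ?thesis
  \<comment> \<open>In these cases the scale \<open>m\<close> chosen below would not be positive;
    but then \<open>g\<close> vanishes almost everywhere.\<close>
  proof (cases "A = 0 \<or> I = 0")
    case True
    have "AE z in M. g z = 0"
    proof (cases "A = 0")
      case True
      then have "emeasure M (space M) = 0"
        by (simp add: A_def emeasure_eq_measure)
      then have "space M \<in> null_sets M" by auto
      from AE_not_in[OF this] show ?thesis
        by (rule AE_mp) (rule AE_I2, simp)
    next
      case False
      then have "AE z in M. \<bar>g z\<bar> powr s = 0"
        using True integral_nonneg_eq_0_iff_AE[OF gs] by (simp add: I_def)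
      then show ?thesis by eventually_elim simp
    qed
    then have "(LINT z|M. g z) = 0"
      by (rule integral_eq_zero_AE)
    then show ?thesis by simp
  next
    case False
    then have A: "0 < A" and I: "0 < I"
      using I0 by (auto simp: A_def zero_less_measure_iff measure_nonneg less_le)
    \<comment> \<open>The constant whose s-th power has the same integral as that of |g|. Young's
      inequality is sharp at |g| = m, and its integrated right-hand side collapses to A * m, which
      is the Hoelder bound.\<close>
    define m where "m = (I / A) powr (1 / s)"
    have m: "0 < m" using A I by (simp add: m_def)
    have ms: "A * m powr s = I"
      using A I s by (simp add: m_def powr_powr)
    have "I * m powr (1 - s) = A * (m powr s * m powr (1 - s))"
      by (simp add: ms[symmetric])
    also have "m powr s * m powr (1 - s) = m"
      using m by (simp flip: powr_add)
    finally have Im: "I * m powr (1 - s) = A * m" .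
    have "\<bar>LINT z|M. g z\<bar> \<le> (LINT z|M. \<bar>g z\<bar>)"
      by (rule integral_abs_bound)
    also have "\<dots> \<le> (LINT z|M. \<bar>g z\<bar> powr s * (m powr (1 - s) / s) + (1 - 1 / s) * m)"
    proof (rule integral_mono)
      show "integrable M (\<lambda>z. \<bar>g z\<bar>)"
        by (rule integrable_abs[OF g])
      show "integrable M (\<lambda>z. \<bar>g z\<bar> powr s * (m powr (1 - s) / s) + (1 - 1 / s) * m)"
        using gs by (intro Bochner_Integration.integrable_add integrable_mult_left) auto
      show "\<bar>g z\<bar> \<le> \<bar>g z\<bar> powr s * (m powr (1 - s) / s) + (1 - 1 / s) * m" for z
        using Young_scaled[of "\<bar>g z\<bar>" m s] m s by simp
    qed
    also have "\<dots> = I * m powr (1 - s) / s + (1 - 1 / s) * m * A"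
      using gs by (subst Bochner_Integration.integral_add) (auto simp: I_def A_def)
    also have "\<dots> = A * m"
      by (simp only: Im) (use s in \<open>simp add: field_simps\<close>)
    also have "\<dots> = A powr (1 - 1 / s) * I powr (1 / s)"
      using A I by (simp add: m_def powr_divide powr_diff)
    finally show ?thesis
      by (simp add: A_def I_def)
  qed
qed

lemma Holder_Lp_norm:
  assumes U: "U \<in> lmeasurable" and p: "1 \<le> p" "1 / p + 1 / q = 1"
    and g: "g \<in> Lp_space p U" "integrable (lebesgue_on U) g"
  shows "\<bar>LINT z|lebesgue_on U. g z\<bar> \<le> area U powr enn2real (1 / q) * Lp_norm p U g"
proof -
  interpret finite_measure "lebesgue_on U"
    using U by (auto intro!: finite_measureI simp: emeasure_restrict_space fmeasurable_def top.not_eq_extremum)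
  have A: "measure (lebesgue_on U) (space (lebesgue_on U)) = area U"
    using U by (simp add: measure_restrict_space fmeasurableD)
  show ?thesis
  proof (cases "p = \<infinity>")
    case True
    let ?e = "esssup (lebesgue_on U) (\<lambda>z. ereal \<bar>g z\<bar>)"
    have fin: "?e < \<infinity>"
      using g(1) True by (simp add: Lp_space_def)
    have "AE z in lebesgue_on U. ereal \<bar>g z\<bar> \<le> ?e"
      by (rule esssup_AE)
    then have bound: "AE z in lebesgue_on U. \<bar>g z\<bar> \<le> real_of_ereal ?e"
      by eventually_elim (use fin in \<open>cases ?e; auto\<close>)
    have "\<bar>LINT z|lebesgue_on U. g z\<bar> \<le> (LINT z|lebesgue_on U. \<bar>g z\<bar>)"
      by (rule integral_abs_bound)
    also have "\<dots> \<le> (LINT z|lebesgue_on U. real_of_ereal ?e)"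
      using bound g(2) by (intro integral_mono_AE) auto
    also have "\<dots> = area U powr 1 * real_of_ereal ?e"
      using A by simp
    finally show ?thesis
      using True enn2real_conjugate(2)[OF p] by (simp add: Lp_norm_def)
  next
    case False
    then have "1 \<le> enn2real p"
      using p(1) by (cases p) auto
    then show ?thesis
      using Holder_powr[of "enn2real p" g] g False enn2real_conjugate(1)[OF p] A
      by (simp add: Lp_norm_def Lp_space_def)
  qed
qed

lemma continuous_on_compact_Lp_space:
  assumes K: "compact K" and g: "continuous_on K g" and p: "1 \<le> p"
  shows "g \<in> Lp_space p K"
proof -
  have m [measurable]: "g \<in> borel_measurable (lebesgue_on K)"
    by (rule borel_measurable_integrable[OF integrable_lebesgue_on_compact[OF K g]])
  show ?thesis
  proof (cases "p = \<infinity>")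
    case True
    obtain B where "\<And>z. z \<in> K \<Longrightarrow> \<bar>g z\<bar> \<le> B"
      using compact_imp_bounded[OF compact_continuous_image[OF g K]] by (auto simp: bounded_iff)
    then have "esssup (lebesgue_on K) (\<lambda>z. ereal \<bar>g z\<bar>) \<le> ereal B"
      by (intro esssup_I AE_I2) auto
    then show ?thesis
      using True m by (auto simp: Lp_space_def intro: le_less_trans)
  next
    case False
    \<comment> \<open>A positive exponent keeps \<open>powr\<close> continuous at the zeros of
      \<open>g\<close>.\<close>
    then have "0 < enn2real p"
      using p by (cases p) auto
    then have "continuous_on K (\<lambda>z. \<bar>g z\<bar> powr enn2real p)"
      using g by (intro continuous_on_powr' continuous_intros) auto
    then show ?thesis
      using False m integrable_lebesgue_on_compact[OF K] by (simp add: Lp_space_def)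
  qed
qed

section \<open>Quadrature on a triangulation\<close>

lemma linear_polys_iff: "P \<in> linear_polys \<longleftrightarrow> (\<exists>k l. linear l \<and> P = (\<lambda>z. k + l z))"
proof
  assume "P \<in> linear_polys"
  then obtain a b c where P: "P = (\<lambda>(x, y). a + b * x + c * y)"
    by (auto simp: linear_polys_def)
  show "\<exists>k l. linear l \<and> P = (\<lambda>z. k + l z)"
    by (intro exI[of _ a] exI[of _ "\<lambda>z. b * fst z + c * snd z"] conjI)
       (auto simp: P fun_eq_iff algebra_simps intro!: linearI)
next
  assume "\<exists>k l. linear l \<and> P = (\<lambda>z. k + l z)"
  then obtain k l where l: "linear l" and P: "P = (\<lambda>z. k + l z)" by auto
  have eq: "l (x, y) = l (1, 0) * x + l (0, 1) * y" for x y
  proof -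
    have "(x, y) = x *\<^sub>R (1, 0) + y *\<^sub>R (0, 1)" by simp
    then show ?thesis
      using linear_add[OF l] linear_cmul[OF l] by (metis mult.commute real_scaleR_def)
  qed
  have "P z = (case z of (x, y) \<Rightarrow> k + l (1, 0) * x + l (0, 1) * y)" for z
    using eq[of "fst z" "snd z"] by (simp add: P case_prod_unfold)
  then have "P = (\<lambda>(x, y). k + l (1, 0) * x + l (0, 1) * y)"
    by (rule ext)
  then show "P \<in> linear_polys"
    by (auto simp: linear_polys_def)
qed

lemma linear_polys_continuous_on: "P \<in> linear_polys \<Longrightarrow> continuous_on S P"
  by (auto simp: linear_polys_def case_prod_unfold intro!: continuous_intros)

lemma triangleE:
  assumes "2 simplex T"
  obtains C where "\<not> affine_dependent C" "card C = 3" "T = convex hull C" "triangle_vertices T = C"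
proof -
  obtain C where C: "\<not> affine_dependent C" "int (card C) = 2 + 1" "T = convex hull C"
    using assms unfolding simplex_def by blast
  show ?thesis
    by (rule that[of C])
       (use C in \<open>auto simp: triangle_vertices_def extreme_point_of_convex_hull_affine_independent\<close>)
qed

lemma triangle_integral_linear_poly:
  assumes "2 simplex T" "P \<in> linear_polys"
  shows "(LINT z|lebesgue_on T. P z) = area T / 3 * (\<Sum>v\<in>triangle_vertices T. P v)"
proof -
  obtain C where C: "\<not> affine_dependent C" "card C = 3" "T = convex hull C" "triangle_vertices T = C"
    using assms(1) by (rule triangleE)
  obtain k l where l: "linear l" and P: "P = (\<lambda>z. k + l z)"
    using assms(2) by (auto simp: linear_polys_iff)
  have "C \<noteq> {}" using C(2) by auto
  then show ?thesis
    using simplex_integral_affine[OF C(1) _ l, of k] C by (simp add: P)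
qed

lemma triangle_interpolation:
  assumes "2 simplex T"
  obtains P where "P \<in> linear_polys" "\<And>v. v \<in> triangle_vertices T \<Longrightarrow> P v = f v"
proof -
  obtain C where C: "\<not> affine_dependent C" "triangle_vertices T = C"
    using assms by (rule triangleE)
  obtain k l where "linear l" "\<And>v. v \<in> C \<Longrightarrow> k + l v = f v"
    by (rule affine_interpolation[OF C(1), of f]) blast
  then show ?thesis
    using C(2) by (intro that[of "\<lambda>z. k + l z"]) (auto simp: linear_polys_iff)
qed

section \<open>Integrals and vertex sums over a triangulation\<close>

context
  fixes \<T> \<Omega>
  assumes tri: "triangulation_of \<T> \<Omega>"
begin

lemma triangulation_finite: "finite \<T>"
  using tri by (simp add: triangulation_of_def triangulation_def)

lemma triangulation_simplex: "T \<in> \<T> \<Longrightarrow> 2 simplex T"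
  using tri by (simp add: triangulation_of_def)

lemma triangulation_Union: "\<Union>\<T> = \<Omega>"
  using tri by (simp add: triangulation_of_def)

lemma triangulation_face: "T \<in> \<T> \<Longrightarrow> T' \<in> \<T> \<Longrightarrow> T \<inter> T' face_of T"
  using tri by (simp add: triangulation_of_def triangulation_def)

text \<open>The intersection is a face of both triangles. A proper face has smaller dimension, so an
  intersection of dimension 2 would coincide with both. A convex set with empty interior is a null
  set.\<close>

lemma triangulation_overlap_negligible:
  assumes T: "T \<in> \<T>" "T' \<in> \<T>" "T \<noteq> T'"
  shows "negligible (T \<inter> T')"
proof -
  have face: "T \<inter> T' face_of T" "T \<inter> T' face_of T'"
    using triangulation_face[OF T(1,2)] triangulation_face[OF T(2,1)] by (simp_all add: Int_commute)
  have dim: "aff_dim T = 2" "aff_dim T' = 2" and conv: "convex T" "convex T'"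
    using T triangulation_simplex by (auto intro: aff_dim_simplex convex_simplex)
  have "aff_dim (T \<inter> T') < 2"
    using face_of_aff_dim_lt[OF conv(1) face(1)] face_of_aff_dim_lt[OF conv(2) face(2)] dim T(3)
    by auto
  then have "interior (T \<inter> T') = {}"
    using aff_dim_nonempty_interior[of "T \<inter> T'"] by fastforce
  then show ?thesis
    using conv by (subst negligible_convex_interior) (auto intro: convex_Int)
qed

lemma triangulation_compact: "T \<in> \<T> \<Longrightarrow> compact T"
  using triangulation_simplex compact_simplex by blast

lemma integral_triangulation:
  assumes f: "continuous_on \<Omega> f"
  shows "(LINT z|lebesgue_on \<Omega>. f z) = (\<Sum>T\<in>\<T>. LINT z|lebesgue_on T. (f z :: real))"
proof -
  have meas: "T \<in> sets lebesgue" if "T \<in> \<T>" for T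
    using triangulation_compact[OF that] by (intro fmeasurableD lmeasurable_compact)
  have to_set: "(LINT z|lebesgue_on S. f z) = (LINT z:S|lebesgue. f z)" if "S \<in> sets lebesgue" for S
    using that by (simp add: integral_restrict_space set_lebesgue_integral_def)
  have "\<Omega> \<in> sets lebesgue"
    using triangulation_finite meas unfolding triangulation_Union[symmetric] by auto
  then have "(LINT z|lebesgue_on \<Omega>. f z) = (LINT z:(\<Union>T\<in>\<T>. T)|lebesgue. f z)"
    using triangulation_Union by (simp add: to_set)
  also have "\<dots> = (\<Sum>T\<in>\<T>. LINT z:T|lebesgue. f z)"
  proof (rule set_integral_finite_UN_AE[OF triangulation_finite])
    fix T T' assume T: "T \<in> \<T>" "T' \<in> \<T>"
    show "AE z in lebesgue. z \<in> T \<and> z \<in> T' \<longrightarrow> T = T'"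
    proof (cases "T = T'")
      case False
      then have "T \<inter> T' \<in> null_sets lebesgue"
        using triangulation_overlap_negligible[OF T] by (simp add: negligible_iff_null_sets)
      from AE_not_in[OF this] show ?thesis
        by eventually_elim auto
    qed simp
  next
    fix T assume T: "T \<in> \<T>"
    then show "T \<in> sets lebesgue" by (rule meas)
    have "continuous_on T f"
      using f T triangulation_Union by (auto intro: continuous_on_subset)
    then have "integrable (lebesgue_on T) f"
      by (rule integrable_lebesgue_on_compact[OF triangulation_compact[OF T]])
    then show "set_integrable lebesgue T f"
      using meas[OF T] by (simp add: integrable_restrict_space set_integrable_def)
  qed
  also have "\<dots> = (\<Sum>T\<in>\<T>. LINT z|lebesgue_on T. f z)"
    by (simp add: to_set meas)
  finally show ?thesis .
qed

text \<open>The weight of a point counts every triangle containing it, so a vertex of one triangle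
  must not lie inside another or in the middle of its edge. The common face excludes this: a vertex
  of \<open>T'\<close> in \<open>T\<close> is extreme in the face \<open>T \<inter> T'\<close>, and
  extreme points of a face of \<open>T\<close> are extreme in \<open>T\<close>.\<close>

lemma triangulation_vertices:
  assumes V: "generated_from \<T> V" and T: "T \<in> \<T>"
  shows "{v \<in> V. v \<in> T} = triangle_vertices T"
proof (intro equalityI subsetI)
  fix v assume "v \<in> {v \<in> V. v \<in> T}"
  then obtain T' where v: "v \<in> T" "T' \<in> \<T>" "v extreme_point_of T'"
    using V by (auto simp: generated_from_def triangle_vertices_def)
  then have "v extreme_point_of T' \<inter> T"
    using extreme_point_of_face[OF triangulation_face[OF v(2) T]] by (auto simp: extreme_point_of_def)
  then have "v extreme_point_of T"
    using extreme_point_of_face[OF triangulation_face[OF T v(2)]] by (simp add: Int_commute)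
  then show "v \<in> triangle_vertices T"
    by (simp add: triangle_vertices_def)
next
  fix v assume "v \<in> triangle_vertices T"
  then show "v \<in> {v \<in> V. v \<in> T}"
    using V T by (auto simp: generated_from_def triangle_vertices_def extreme_point_of_def)
qed

lemma quadrature_sum_by_triangles:
  assumes V: "generated_from \<T> V" and fin: "finite V"
  shows "(\<Sum>v\<in>V. quad_weight \<T> v * F v) = (\<Sum>T\<in>\<T>. area T / 3 * (\<Sum>v\<in>triangle_vertices T. F v))"
proof -
  have "(\<Sum>v\<in>V. quad_weight \<T> v * F v) = (\<Sum>v\<in>V. \<Sum>T | T \<in> \<T> \<and> v \<in> T. area T / 3 * F v)"
    by (simp add: quad_weight_def sum_distrib_right)
  also have "\<dots> = (\<Sum>T\<in>\<T>. \<Sum>v | v \<in> V \<and> v \<in> T. area T / 3 * F v)"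
    by (rule sum.swap_restrict[OF fin triangulation_finite])
  also have "\<dots> = (\<Sum>T\<in>\<T>. area T / 3 * (\<Sum>v\<in>triangle_vertices T. F v))"
    using triangulation_vertices[OF V] by (intro sum.cong) (simp_all add: sum_distrib_left)
  finally show ?thesis .
qed

lemma quadrature_exact:
  assumes "generated_from \<T> V" "finite V" "P \<in> linear_polys"
  shows "(\<Sum>v\<in>V. quad_weight \<T> v * P v) = (LINT z|lebesgue_on \<Omega>. P z)"
  using assms
  by (simp add: quadrature_sum_by_triangles integral_triangulation linear_polys_continuous_on
      triangle_integral_linear_poly triangulation_simplex)

lemma longest_edge_bounds:
  assumes T: "T \<in> \<T>"
  shows "0 \<le> longest_edge T" "longest_edge T \<le> mesh_size \<T>"
proof -
  obtain C where C: "card C = 3" "triangle_vertices T = C"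
    using triangulation_simplex[OF T] by (rule triangleE)
  let ?D = "{dist v w | v w. v \<in> triangle_vertices T \<and> w \<in> triangle_vertices T}"
  have "?D = (\<lambda>(v, w). dist v w) ` (C \<times> C)"
    using C by auto
  moreover have "finite C"
    by (rule card_ge_0_finite) (simp add: C(1))
  ultimately have "finite ?D" by simp
  moreover obtain v where "v \<in> C"
    using C(1) by (cases "C = {}") auto
  then have "0 \<in> ?D"
    using C(2) by (intro CollectI exI[of _ v]) simp
  ultimately show "0 \<le> longest_edge T"
    unfolding longest_edge_def by (rule Max_ge)
  show "longest_edge T \<le> mesh_size \<T>"
    unfolding mesh_size_def using T triangulation_finite by (intro Max_ge) auto
qed

lemma triangle_quadrature_error:
  assumes T: "T \<in> \<T>" and p: "1 \<le> p" "1 / p + 1 / q = 1"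
    and K: "0 \<le> K" "interpolation_const p \<T> K"
    and f: "f \<in> sobolev_space 2 p (interior \<Omega>)" "continuous_on \<Omega> f"
  shows "\<bar>(LINT z|lebesgue_on T. f z) - area T / 3 * (\<Sum>v\<in>triangle_vertices T. f v)\<bar>
    \<le> area T powr enn2real (1 / q) * (K * mesh_size \<T> ^ 2 * sobolev_seminorm 2 p (interior \<Omega>) f)"
proof -
  note T2 = triangulation_simplex[OF T] and comp = triangulation_compact[OF T]
  obtain P where P: "P \<in> linear_polys" "\<And>v. v \<in> triangle_vertices T \<Longrightarrow> P v = f v"
    by (rule triangle_interpolation[OF T2, of f]) blast
  have sub: "T \<subseteq> \<Omega>"
    using T triangulation_Union by auto
  then have int_sub: "interior T \<subseteq> interior \<Omega>"
    by (rule interior_mono)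
  have fT: "continuous_on T f"
    by (rule continuous_on_subset[OF f(2) sub])
  have PT: "continuous_on T P"
    by (rule linear_polys_continuous_on[OF P(1)])
  have diff: "continuous_on T (\<lambda>z. f z - P z)"
    by (intro continuous_intros fT PT)
  have fS: "f \<in> sobolev_space 2 p (interior T)"
    by (rule sobolev_space_restrict[OF int_sub open_interior open_interior f(1)])
  have semi: "sobolev_seminorm 2 p (interior T) f \<le> sobolev_seminorm 2 p (interior \<Omega>) f"
    by (rule sobolev_seminorm_mono[OF int_sub open_interior open_interior f(1)])
  have semi0: "0 \<le> sobolev_seminorm 2 p (interior T) f"
    by (rule sobolev_seminorm_nonneg[OF open_interior fS])
  have "(LINT z|lebesgue_on T. f z - P z) =
      (LINT z|lebesgue_on T. f z) - area T / 3 * (\<Sum>v\<in>triangle_vertices T. f v)"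
    using integrable_lebesgue_on_compact[OF comp fT] integrable_lebesgue_on_compact[OF comp PT]
      triangle_integral_linear_poly[OF T2 P(1)] P(2)
    by simp
  then have "\<bar>(LINT z|lebesgue_on T. f z) - area T / 3 * (\<Sum>v\<in>triangle_vertices T. f v)\<bar>
      = \<bar>LINT z|lebesgue_on T. f z - P z\<bar>"
    by simp
  also have "\<dots> \<le> area T powr enn2real (1 / q) * Lp_norm p T (\<lambda>z. f z - P z)"
    by (intro Holder_Lp_norm lmeasurable_compact comp p continuous_on_compact_Lp_space diff
        integrable_lebesgue_on_compact)
  also have "\<dots> \<le> area T powr enn2real (1 / q) *
      (K * longest_edge T ^ 2 * sobolev_seminorm 2 p (interior T) f)"
    using K(2) T fS fT P unfolding interpolation_const_def
    by (intro mult_left_mono) auto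
  also have "\<dots> \<le> area T powr enn2real (1 / q) *
      (K * mesh_size \<T> ^ 2 * sobolev_seminorm 2 p (interior \<Omega>) f)"
    using longest_edge_bounds[OF T] K(1) semi semi0
    by (intro mult_left_mono mult_mono power_mono) auto
  finally show ?thesis .
qed

end

text \<open>Applying the hypothesis at \<open>r = \<infinity>\<close> rather than at \<open>r = p\<close> avoids a factor \<open>|\<T>|\<^bsup>2/p\<^esup>\<close>,
  which the error bound does not contain.\<close>

lemma mesh_count_const_infinity:
  assumes "mesh_count_const \<T> C" "0 \<le> C"
  shows "real (card \<T>) * mesh_size \<T> ^ 2 \<le> C"
proof -
  have *: "real (card \<T>) powr (1 - enn2real (1 / \<infinity>)) * mesh_size \<T> ^ 2
      \<le> C * mesh_size \<T> powr (2 * enn2real (1 / \<infinity>))"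
    using assms(1)[unfolded mesh_count_const_def, THEN spec, of \<infinity>] by (rule mp) simp
  show ?thesis
  \<comment> \<open>Since \<open>0 powr 0 = 0\<close>, the hypothesis is empty for mesh size 0,
    where the claim is just \<open>0 \<le> C\<close>.\<close>
  proof (cases "mesh_size \<T> = 0")
    case False
    then show ?thesis using * by simp
  qed (use assms(2) in simp)
qed

theorem theorem3p5:
  fixes \<Omega> :: "(real \<times> real) set" and \<T> :: "(real \<times> real) set set"
    and x y :: "nat \<Rightarrow> real" and m :: nat
  assumes "polygon \<Omega>"
    and "inj_on (\<lambda>j. (x j, y j)) {1..m}"
    and "(\<lambda>j. (x j, y j)) ` {1..m} \<subseteq> \<Omega>"
    and "polygon_vertices \<Omega> \<subseteq> (\<lambda>j. (x j, y j)) ` {1..m}"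
    and "triangulation_of \<T> \<Omega>"
    and "generated_from \<T> ((\<lambda>j. (x j, y j)) ` {1..m})"
  defines "w \<equiv> \<lambda>j. quad_weight \<T> (x j, y j)"
  shows "(\<forall>P\<in>linear_polys. (\<Sum>j=1..m. w j * P (x j, y j)) = (LINT z|lebesgue_on \<Omega>. P z)) \<and>
    (\<forall>(p::ennreal) (q::ennreal) (K1::real) (C7::real) f.
       1 \<le> p \<and> 1 / p + 1 / q = 1 \<and>
       K1 > 0 \<and> interpolation_const p \<T> K1 \<and>
       C7 > 0 \<and> mesh_count_const \<T> C7 \<and>
       f \<in> sobolev_space 2 p (interior \<Omega>) \<and> continuous_on \<Omega> f \<longrightarrow>
       \<bar>(LINT z|lebesgue_on \<Omega>. f z) - (\<Sum>j=1..m. w j * f (x j, y j))\<bar>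
       \<le> K1 * C7 * Max ((\<lambda>T. area T powr enn2real (1 / q)) ` \<T>)
            * sobolev_seminorm 2 p (interior \<Omega>) f)"
proof -
  let ?V = "(\<lambda>j. (x j, y j)) ` {1..m}"
  note tri = assms(5) and gen = assms(6)
  \<comment> \<open>The points are pairwise distinct, so summing over indices counts each vertex
    once.\<close>
  have sum_V: "(\<Sum>j=1..m. w j * F (x j, y j)) = (\<Sum>v\<in>?V. quad_weight \<T> v * F v)" for F
    using assms(2) by (simp add: sum.reindex w_def)
  show ?thesis
  proof (intro conjI ballI allI impI; (elim conjE)?)
    fix P :: "real \<times> real \<Rightarrow> real"
    assume "P \<in> linear_polys"
    then show "(\<Sum>j=1..m. w j * P (x j, y j)) = (LINT z|lebesgue_on \<Omega>. P z)"
      unfolding sum_V by (intro quadrature_exact[OF tri gen]) auto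
  next
    fix p q :: ennreal and K1 C7 :: real and f :: "real \<times> real \<Rightarrow> real"
    assume p: "1 \<le> p" "1 / p + 1 / q = 1"
      and K1: "K1 > 0" "interpolation_const p \<T> K1"
      and C7: "C7 > 0" "mesh_count_const \<T> C7"
      and f: "f \<in> sobolev_space 2 p (interior \<Omega>)" "continuous_on \<Omega> f"
    let ?S = "sobolev_seminorm 2 p (interior \<Omega>) f"
    let ?A = "\<lambda>T. area T powr enn2real (1 / q)"
    let ?M = "Max (?A ` \<T>)"
    note fin = triangulation_finite[OF tri]
    \<comment> \<open>\<open>Max\<close> of an empty set would be unspecified; a polygon has
      nonempty interior, so it cannot be covered by no triangles.\<close>
    have "\<T> \<noteq> {}"
      using assms(1) triangulation_Union[OF tri] by (auto simp: polygon_def)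
    then obtain T0 where "T0 \<in> \<T>" by auto
    then have "?A T0 \<le> ?M"
      using fin by (intro Max_ge) auto
    then have M0: "0 \<le> ?M"
      by (rule order_trans[OF powr_ge_zero])
    have S0: "0 \<le> ?S"
      by (rule sobolev_seminorm_nonneg[OF open_interior f(1)])
    have "(LINT z|lebesgue_on \<Omega>. f z) - (\<Sum>j=1..m. w j * f (x j, y j)) =
        (\<Sum>T\<in>\<T>. (LINT z|lebesgue_on T. f z) - area T / 3 * (\<Sum>v\<in>triangle_vertices T. f v))"
      unfolding sum_V quadrature_sum_by_triangles[OF tri gen finite_imageI[OF finite_atLeastAtMost]]
        integral_triangulation[OF tri f(2)] by (rule sum_subtractf[symmetric])
    also have "\<bar>\<dots>\<bar> \<le> (\<Sum>T\<in>\<T>. \<bar>(LINT z|lebesgue_on T. f z) - area T / 3 * (\<Sum>v\<in>triangle_vertices T. f v)\<bar>)"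
      by (rule sum_abs)
    also have "\<dots> \<le> (\<Sum>T\<in>\<T>. ?M * (K1 * mesh_size \<T> ^ 2 * ?S))"
    proof (rule sum_mono)
      fix T assume T: "T \<in> \<T>"
      have "\<bar>(LINT z|lebesgue_on T. f z) - area T / 3 * (\<Sum>v\<in>triangle_vertices T. f v)\<bar>
          \<le> ?A T * (K1 * mesh_size \<T> ^ 2 * ?S)"
        using K1 by (intro triangle_quadrature_error[OF tri T p _ _ f]) auto
      also have "\<dots> \<le> ?M * (K1 * mesh_size \<T> ^ 2 * ?S)"
        using fin T K1 S0 by (intro mult_right_mono Max_ge) auto
      finally show "\<bar>(LINT z|lebesgue_on T. f z) - area T / 3 * (\<Sum>v\<in>triangle_vertices T. f v)\<bar>
          \<le> ?M * (K1 * mesh_size \<T> ^ 2 * ?S)" .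
    qed
    also have "\<dots> = K1 * (real (card \<T>) * mesh_size \<T> ^ 2) * ?M * ?S"
      by simp
    also have "\<dots> \<le> K1 * C7 * ?M * ?S"
      using mesh_count_const_infinity[OF C7(2)] C7(1) K1(1) M0 S0
      by (intro mult_right_mono mult_left_mono) auto
    finally show "\<bar>(LINT z|lebesgue_on \<Omega>. f z) - (\<Sum>j=1..m. w j * f (x j, y j))\<bar>
        \<le> K1 * C7 * ?M * ?S" .
  qed
qed

end
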